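(* Let $\mathcal{H}$ be a string hypergraph. Then $\mathrm{ara}(\mathcal{H}) = \mathrm{biara}(\mathcal{H}) = \mathrm{pd}(\mathcal{H})$. Equivalently: if $K$ is any field, $R=K[x_1,\dots,x_n]$, and $I\subset R$ is a squarefree monomial ideal such that $\mathcal{H}(I)$ is a string hypergraph, then $\mathrm{ara}\, I = \mathrm{biara}\, I = \mathrm{pd}\, R/I$.
   Context: Let $R=K[x_1,\dots,x_n]$ be a polynomial ring over a field $K$. For a squarefree monomial ideal $I$ with minimal monomial generators $m_1,\dots,m_\mu$, the associated hypergraph on the vertex set $[\mu]=\{1,\dots,\mu\}$ is $\mathcal{H}(I)=\{\{j\in[\mu]: x_i\mid m_j\} : x_i \text{ divides some } m_j\}$; its elements are called faces. A vertex $j$ is closed if $\{j\}$ is a face and open otherwise. A hypergraph $\mathcal{H}$ on $[\mu]$ ($\mu\ge 2$) is a string if $\{j,j+1\}\in\mathcal{H}$ for all $j=1,\dots,\mu-1$ and all other faces are of the form $\{j\}$. The arithmetical rank $\mathrm{ara}\, I$ is the least $u$ such that there exist $q_1,\dots,q_u\in R$ with $\sqrt{(q_1,\dots,q_u)}=\sqrt I$; the binomial arithmetical rank $\mathrm{biara}\, I$ is the same minimum where each $q_i$ is required to be a monomial or a binomial. For a hypergraph $\mathcal{H}$ of the form $\mathcal{H}(I)$, $\mathrm{pd}(\mathcal{H}):=\mathrm{pd}\, R/I$, $\mathrm{ara}(\mathcal{H}):=\mathrm{ara}\, I$, $\mathrm{biara}(\mathcal{H}):=\mathrm{biara}\, I$;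 these depend only on $\mathcal{H}$, not on the choice of $I$ (nor of the polynomial ring). *)

theory Defs
  imports Main "HOL-Library.Poly_Mapping"
begin

text \<open>Polynomials over a field 'k in the variables indexed by a finite type 'v
  (so n = CARD('v)): finitely supported maps from exponent vectors to coefficients.\<close>
type_synonym ('v, 'k) mpoly = "('v \<Rightarrow>\<^sub>0 nat) \<Rightarrow>\<^sub>0 'k"

definition Var :: "'v \<Rightarrow> ('v, 'k::comm_ring_1) mpoly" where
  "Var v = Poly_Mapping.single (Poly_Mapping.single v 1) 1"

definition sqf_monomial :: "'v set \<Rightarrow> ('v, 'k::comm_ring_1) mpoly" where
  "sqf_monomial S = (\<Prod>v\<in>S. Var v)"

definition ideal_gen :: "('v, 'k::comm_ring_1) mpoly set \<Rightarrow> ('v, 'k) mpoly set" where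
  "ideal_gen G = {p. \<exists>F r. finite F \<and> F \<subseteq> G \<and> p = (\<Sum>g\<in>F. r g * g)}"

definition radical :: "('v, 'k::comm_ring_1) mpoly set \<Rightarrow> ('v, 'k) mpoly set" where
  "radical I = {p. \<exists>k. p ^ k \<in> I}"

definition sqf_ideal :: "(nat \<Rightarrow> 'v set) \<Rightarrow> nat \<Rightarrow> ('v, 'k::comm_ring_1) mpoly set" where
  "sqf_ideal ms \<mu> = ideal_gen (sqf_monomial ` ms ` {1..\<mu>})"

definition assoc_hypergraph :: "(nat \<Rightarrow> 'v set) \<Rightarrow> nat \<Rightarrow> nat set set" where
  "assoc_hypergraph ms \<mu> =
     {{j \<in> {1..\<mu>}. v \<in> ms j} | v. \<exists>j\<in>{1..\<mu>}. v \<in> ms j}"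

definition is_string :: "nat set set \<Rightarrow> nat \<Rightarrow> bool" where
  "is_string H \<mu> \<longleftrightarrow> 2 \<le> \<mu> \<and>
     (\<forall>j\<in>{1..<\<mu>}. {j, j+1} \<in> H) \<and>
     (\<forall>F\<in>H. (\<exists>j\<in>{1..<\<mu>}. F = {j, j+1}) \<or> (\<exists>j\<in>{1..\<mu>}. F = {j}))"

definition ara :: "('v, 'k::comm_ring_1) mpoly set \<Rightarrow> nat" where
  "ara I = (LEAST u. \<exists>q :: nat \<Rightarrow> ('v, 'k) mpoly.
              radical (ideal_gen (q ` {..<u})) = radical I)"

definition mono_or_binomial :: "('v, 'k::comm_ring_1) mpoly \<Rightarrow> bool" where
  "mono_or_binomial p \<longleftrightarrow> card (Poly_Mapping.keys p) \<le> 2"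

definition biara :: "('v, 'k::comm_ring_1) mpoly set \<Rightarrow> nat" where
  "biara I = (LEAST u. \<exists>q :: nat \<Rightarrow> ('v, 'k) mpoly.
              (\<forall>i<u. mono_or_binomial (q i)) \<and>
              radical (ideal_gen (q ` {..<u})) = radical I)"

definition free_mod :: "nat \<Rightarrow> (nat \<Rightarrow> ('v, 'k::comm_ring_1) mpoly) set" where
  "free_mod b = {x. \<forall>k\<ge>b. x k = 0}"

definition matapp :: "(nat \<Rightarrow> nat \<Rightarrow> ('v, 'k::comm_ring_1) mpoly) \<Rightarrow> nat \<Rightarrow> nat
     \<Rightarrow> (nat \<Rightarrow> ('v, 'k) mpoly) \<Rightarrow> nat \<Rightarrow> ('v, 'k) mpoly" where
  "matapp A m b x = (\<lambda>r. if r < m then (\<Sum>c<b. A r c * x c) else 0)"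

text \<open>An exact sequence
   0 \<rightarrow> R^(b p) --d p--> ... --d 1--> R^(b 0) --eps--> R/I \<rightarrow> 0,
  where eps sends the k-th basis vector to the class of e k.\<close>
definition is_free_resolution ::
  "('v, 'k::comm_ring_1) mpoly set \<Rightarrow> nat \<Rightarrow> (nat \<Rightarrow> nat)
     \<Rightarrow> (nat \<Rightarrow> nat \<Rightarrow> nat \<Rightarrow> ('v, 'k) mpoly) \<Rightarrow> (nat \<Rightarrow> ('v, 'k) mpoly) \<Rightarrow> bool" where
  "is_free_resolution I p b d e \<longleftrightarrow>
     \<comment> \<open>eps surjective\<close>
     (\<forall>f. \<exists>x\<in>free_mod (b 0). f - (\<Sum>k<b 0. x k * e k) \<in> I) \<and>
     \<comment> \<open>exactness at R^(b 0)\<close>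
     (if p = 0 then (\<forall>x\<in>free_mod (b 0). (\<Sum>k<b 0. x k * e k) \<in> I \<longrightarrow> x = (\<lambda>_. 0))
      else {x\<in>free_mod (b 0). (\<Sum>k<b 0. x k * e k) \<in> I}
             = matapp (d 1) (b 0) (b 1) ` free_mod (b 1)) \<and>
     \<comment> \<open>exactness at R^(b i), 0 < i < p\<close>
     (\<forall>i. 0 < i \<and> i < p \<longrightarrow>
        {x\<in>free_mod (b i). matapp (d i) (b (i-1)) (b i) x = (\<lambda>_. 0)}
          = matapp (d (i+1)) (b i) (b (i+1)) ` free_mod (b (i+1))) \<and>
     \<comment> \<open>injectivity of d p\<close>
     (0 < p \<longrightarrow> (\<forall>x\<in>free_mod (b p). matapp (d p) (b (p-1)) (b p) x = (\<lambda>_. 0) \<longrightarrow> x = (\<lambda>_. 0)))"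

definition pd_quot :: "('v, 'k::comm_ring_1) mpoly set \<Rightarrow> nat" where
  "pd_quot I = (LEAST p. \<exists>b d e. is_free_resolution I p b d e)"

end

theory Submission
  imports Defs "HOL-Library.FuncSet" "HOL-Library.Function_Algebras" "HOL.Vector_Spaces"
begin

text \<open>All three numbers equal the largest size of a minimal cover of the generators by variables,
  which satisfies a recursion along the string: if the vertex before the last is closed, the last
  vertex contributes 1, and otherwise the last three vertices contribute 2 together.

  Upper bounds: in the open case the middle generator \<open>m\<close> divides the product of its two
  neighbours \<open>a\<close> and \<open>b\<close>, so \<open>m\<close> and \<open>a + b\<close> replace the three generators up to radical; and
  adding one generator \<open>m\<close> to an ideal \<open>J\<close> gives a resolution of length at most the maximum of
  the projective dimension of \<open>R/J\<close> and one more than that of \<open>R/(J : m)\<close>, where \<open>J : m\<close> is again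
  the ideal of a shorter string.

  Lower bounds: let \<open>C\<close> be a minimal cover. Setting the variables outside \<open>C\<close> to 1 turns the ideal
  into the maximal ideal of the polynomial ring in \<open>C\<close>, which needs \<open>|C|\<close> generators up to radical by
  a dimension count. The product of the variables outside \<open>C\<close> is a nonzero element of \<open>R/I\<close> killed
  by the regular sequence of the variables in \<open>C\<close>, which forces resolutions to have length at
  least \<open>|C|\<close>.\<close>

text \<open>The inductions pass through families of length 0 and 1 and through families from which
  variables have been removed, so they run over sequences of variable sets instead of hypergraphs.
  Openness of the inner vertices is carried along as a fixed predicate; the original and the
  shrunken family then share the same rank function. The step of three in the open case has its
  origin in the colon by the last generator. There the second last generator loses the variables it
  shares with the last one. If its vertex is closed, a private variable survives and the colon is a
  string with one vertex fewer. If it is open, what remains divides the third last generator, which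
  becomes redundant, and is coprime to all earlier ones: the colon is a string with three vertices
  fewer and one independent extra generator. The lower bounds stay inside one polynomial ring.
  Quotients by variables are congruences modulo an ideal, the substitution of 1 has its values in
  the same ring, and in the dimension count truncation by degree supplies representatives.\<close>

abbreviation "keys \<equiv> Poly_Mapping.keys"
abbreviation "lookup \<equiv> Poly_Mapping.lookup"
abbreviation "single \<equiv> Poly_Mapping.single"

subsection \<open>Ideals and radicals\<close>

definition is_ideal :: "'a::comm_ring_1 set \<Rightarrow> bool" where
  "is_ideal J \<longleftrightarrow> 0 \<in> J \<and> (\<forall>a\<in>J. \<forall>b\<in>J. a + b \<in> J) \<and> (\<forall>r. \<forall>a\<in>J. r * a \<in> J)"

lemma is_ideal_zero: "is_ideal J \<Longrightarrow> 0 \<in> J"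
  and is_ideal_add: "is_ideal J \<Longrightarrow> a \<in> J \<Longrightarrow> b \<in> J \<Longrightarrow> a + b \<in> J"
  and is_ideal_mult: "is_ideal J \<Longrightarrow> a \<in> J \<Longrightarrow> r * a \<in> J"
  by (auto simp: is_ideal_def)

lemma is_ideal_uminus: "is_ideal J \<Longrightarrow> a \<in> J \<Longrightarrow> - a \<in> J"
  using is_ideal_mult[of J a "-1"] by simp

lemma is_ideal_diff: "is_ideal J \<Longrightarrow> a \<in> J \<Longrightarrow> b \<in> J \<Longrightarrow> a - b \<in> J"
  using is_ideal_add[of J a "- b"] is_ideal_uminus[of J b] by simp

lemma is_ideal_sum: "is_ideal J \<Longrightarrow> (\<And>i. i \<in> A \<Longrightarrow> f i \<in> J) \<Longrightarrow> sum f A \<in> J"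
  by (induction A rule: infinite_finite_induct) (auto simp: is_ideal_zero is_ideal_add)

lemma is_ideal_power_mono:
  assumes "is_ideal J" "a ^ m \<in> J" "m \<le> n" shows "a ^ n \<in> J"
  using is_ideal_mult[OF assms(1,2), of "a ^ (n - m)"] assms(3)
  by (simp add: power_add[symmetric])

lemma is_ideal_ideal_gen: "is_ideal (ideal_gen G)"
proof -
  have add: "a + b \<in> ideal_gen G" if a: "a \<in> ideal_gen G" and b: "b \<in> ideal_gen G" for a b
  proof -
    obtain F r where F: "finite F" "F \<subseteq> G" "a = (\<Sum>g\<in>F. r g * g)"
      using a by (auto simp: ideal_gen_def)
    obtain F' r' where F': "finite F'" "F' \<subseteq> G" "b = (\<Sum>g\<in>F'. r' g * g)"
      using b by (auto simp: ideal_gen_def)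
    let ?s = "\<lambda>g. (if g \<in> F then r g else 0) + (if g \<in> F' then r' g else 0)"
    have "a = (\<Sum>g\<in>F \<union> F'. (if g \<in> F then r g else 0) * g)"
      unfolding F(3) using F F' by (intro sum.mono_neutral_cong_left) auto
    moreover have "b = (\<Sum>g\<in>F \<union> F'. (if g \<in> F' then r' g else 0) * g)"
      unfolding F'(3) using F F' by (intro sum.mono_neutral_cong_left) auto
    ultimately have "a + b = (\<Sum>g\<in>F \<union> F'. ?s g * g)"
      by (simp only: distrib_right sum.distrib)
    then show ?thesis
      unfolding ideal_gen_def using F F'
      by (intro CollectI exI[of _ "F \<union> F'"] exI[of _ ?s]) auto
  qed
  have mult: "s * a \<in> ideal_gen G" if a: "a \<in> ideal_gen G" for a s
  proof -
    obtain F r where F: "finite F" "F \<subseteq> G" "a = (\<Sum>g\<in>F. r g * g)"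
      using a by (auto simp: ideal_gen_def)
    have "s * a = (\<Sum>g\<in>F. (s * r g) * g)"
      by (simp add: F(3) sum_distrib_left mult.assoc)
    then show ?thesis
      unfolding ideal_gen_def using F
      by (intro CollectI exI[of _ F] exI[of _ "\<lambda>g. s * r g"]) auto
  qed
  have "0 \<in> ideal_gen G"
    unfolding ideal_gen_def by (intro CollectI exI[of _ "{}"]) auto
  then show ?thesis
    using add mult by (auto simp: is_ideal_def)
qed

lemma ideal_gen_superset: "g \<in> G \<Longrightarrow> g \<in> ideal_gen G"
  unfolding ideal_gen_def by (intro CollectI exI[of _ "{g}"] exI[of _ "\<lambda>_. 1"]) auto

lemma ideal_gen_subset:
  assumes "is_ideal J" "G \<subseteq> J" shows "ideal_gen G \<subseteq> J"
proof
  fix p assume "p \<in> ideal_gen G"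
  then obtain F r where F: "finite F" "F \<subseteq> G" "p = (\<Sum>g\<in>F. r g * g)"
    by (auto simp: ideal_gen_def)
  then show "p \<in> J"
    using assms by (auto intro!: is_ideal_sum is_ideal_mult)
qed

lemma ideal_gen_mono: "G \<subseteq> H \<Longrightarrow> ideal_gen G \<subseteq> ideal_gen H"
  by (intro ideal_gen_subset is_ideal_ideal_gen) (auto intro: ideal_gen_superset)

text \<open>\<open>ideal_gen\<close> sums over a set of values, so repetitions in the family
  \<open>q\<close> collapse and indexed coefficients cannot be read off. The indexed combinations
  form an ideal containing every \<open>q i\<close>, which is enough.\<close>

lemma ideal_gen_finite_image:
  assumes "p \<in> ideal_gen (q ` {..<u::nat})"
  shows "\<exists>r. p = (\<Sum>i<u. r i * q i)"
proof -
  let ?J = "{p. \<exists>r. p = (\<Sum>i<u. r i * q i)}"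
  have "is_ideal ?J"
    unfolding is_ideal_def
  proof (intro conjI ballI allI)
    show "0 \<in> ?J" by (auto intro: exI[of _ "\<lambda>_. 0"])
  next
    fix a b assume "a \<in> ?J" "b \<in> ?J"
    then obtain r s where "a = (\<Sum>i<u. r i * q i)" "b = (\<Sum>i<u. s i * q i)" by auto
    then have "a + b = (\<Sum>i<u. (r i + s i) * q i)" by (simp add: distrib_right sum.distrib)
    then show "a + b \<in> ?J" by (intro CollectI exI[of _ "\<lambda>i. r i + s i"])
  next
    fix t a assume "a \<in> ?J"
    then obtain r where "a = (\<Sum>i<u. r i * q i)" by auto
    then have "t * a = (\<Sum>i<u. (t * r i) * q i)" by (simp add: sum_distrib_left mult.assoc)
    then show "t * a \<in> ?J" by (intro CollectI exI[of _ "\<lambda>i. t * r i"])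
  qed
  moreover have "q ` {..<u} \<subseteq> ?J"
  proof
    fix x assume "x \<in> q ` {..<u}"
    then obtain j where "j < u" "x = q j" by auto
    then have "x = (\<Sum>i<u. (if i = j then 1 else 0) * q i)"
      by (simp add: if_distrib[of "\<lambda>a. a * _"] cong: if_cong)
    then show "x \<in> ?J" by (intro CollectI exI[of _ "\<lambda>i. if i = j then 1 else 0"])
  qed
  ultimately show ?thesis using ideal_gen_subset assms by blast
qed

lemma is_ideal_radical:
  assumes J: "is_ideal J" shows "is_ideal (radical J)"
proof -
  have "a + b \<in> radical J" if "a \<in> radical J" "b \<in> radical J" for a b
  proof -
    obtain m n where mn: "a ^ m \<in> J" "b ^ n \<in> J"
      using \<open>a \<in> radical J\<close> \<open>b \<in> radical J\<close> by (auto simp: radical_def)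
    have "of_nat (m + n choose k) * a ^ k * b ^ (m + n - k) \<in> J" for k
    proof (cases "m \<le> k")
      case True
      then have "of_nat (m + n choose k) * b ^ (m + n - k) * a ^ k \<in> J"
        using J mn by (intro is_ideal_mult) (auto intro: is_ideal_power_mono)
      then show ?thesis by (simp add: ac_simps)
    next
      case False
      then have "n \<le> m + n - k" by simp
      then show ?thesis using J mn by (intro is_ideal_mult) (auto intro: is_ideal_power_mono)
    qed
    then have "(a + b) ^ (m + n) \<in> J"
      unfolding binomial_ring by (intro is_ideal_sum J)
    then show ?thesis by (auto simp: radical_def)
  qed
  moreover have "r * a \<in> radical J" if "a \<in> radical J" for a r
    using that is_ideal_mult[OF J] by (fastforce simp: radical_def power_mult_distrib)
  moreover have "0 \<in> radical J"
    unfolding radical_def by (intro CollectI exI[of _ 1]) (simp add: is_ideal_zero J)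
  ultimately show ?thesis by (auto simp: is_ideal_def)
qed

lemma radical_superset: "J \<subseteq> radical J"
  by (auto simp: radical_def intro: exI[of _ 1])

lemma radical_mono: "I \<subseteq> J \<Longrightarrow> radical I \<subseteq> radical J"
  by (auto simp: radical_def)

lemma radical_idem: "radical (radical J) = radical J"
proof
  show "radical (radical J) \<subseteq> radical J"
    by (auto simp: radical_def power_mult[symmetric])
qed (rule radical_superset)

lemma radical_ideal_gen_eqI:
  assumes "Q \<subseteq> ideal_gen G" "G \<subseteq> radical (ideal_gen Q)"
  shows "radical (ideal_gen Q) = radical (ideal_gen G)"
proof
  show "radical (ideal_gen Q) \<subseteq> radical (ideal_gen G)"
    by (intro radical_mono ideal_gen_subset is_ideal_ideal_gen assms)
  have "ideal_gen G \<subseteq> radical (ideal_gen Q)"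
    by (intro ideal_gen_subset is_ideal_radical is_ideal_ideal_gen assms)
  then show "radical (ideal_gen G) \<subseteq> radical (ideal_gen Q)"
    using radical_mono radical_idem by blast
qed

subsection \<open>Squarefree monomial ideals\<close>

definition expo :: "'v set \<Rightarrow> 'v \<Rightarrow>\<^sub>0 nat" where
  "expo S = (\<Sum>v\<in>S. single v 1)"

lemma lookup_expo: "lookup (expo S) (v :: 'v::finite) = (if v \<in> S then 1 else 0)"
  by (simp add: expo_def lookup_sum lookup_single when_def)

lemma keys_expo [simp]: "keys (expo S) = (S :: 'v::finite set)"
  by (auto simp: in_keys_iff lookup_expo split: if_splits)

lemma sqf_monomial_eq_single: "sqf_monomial S = single (expo (S :: 'v::finite set)) 1"
proof (induction S rule: infinite_finite_induct)
  case (insert v S)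
  then show ?case
    by (simp add: sqf_monomial_def expo_def Var_def mult_single)
qed (auto simp: sqf_monomial_def expo_def)

lemma keys_add_nat: "keys (s + t :: 'v \<Rightarrow>\<^sub>0 nat) = keys s \<union> keys t"
  by (auto simp: in_keys_iff lookup_add)

lemma poly_mapping_sum_single:
  "(\<Sum>t\<in>keys f. single t (lookup f t)) = f"
  by (rule poly_mapping_eqI)
    (auto simp: lookup_sum lookup_single when_def in_keys_iff)

lemma poly_mapping_add_induct [case_names single add zero]:
  assumes "\<And>t a. P (single t a)" "\<And>f g. P f \<Longrightarrow> P g \<Longrightarrow> P (f + g)" "P 0"
  shows "P (f :: 'a \<Rightarrow>\<^sub>0 'b::comm_monoid_add)"
proof -
  have "P (\<Sum>t\<in>A. single t (lookup f t))" if "finite A" for A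
    using that by induction (auto intro: assms)
  from this[of "keys f"] show ?thesis by (simp add: poly_mapping_sum_single)
qed

lemma lookup_mult_single:
  fixes f :: "('v, 'k::comm_ring_1) mpoly"
  shows "lookup (f * single s 1) (t + s) = lookup f t"
proof (induction f rule: poly_mapping_add_induct)
  case (single u a)
  then show ?case by (simp add: mult_single lookup_single when_def)
qed (simp_all add: distrib_right lookup_add)

lemma keys_mult_single:
  fixes f :: "('v, 'k::comm_ring_1) mpoly"
  shows "keys (f * single s 1) = (\<lambda>t. t + s) ` keys f"
proof
  show "keys (f * single s 1) \<subseteq> (\<lambda>t. t + s) ` keys f"
    using keys_mult[of f "single s 1"] by auto
qed (auto simp: in_keys_iff lookup_mult_single)

text \<open>The ideal generated by the monomials of \<S>, described through supports. Membership is
  decided one monomial at a time, which turns comparisons and colons of ideals into operations on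
  sets.\<close>

definition mono_ideal :: "'v set set \<Rightarrow> ('v, 'k::comm_ring_1) mpoly set" where
  "mono_ideal \<S> = {p. \<forall>t\<in>keys p. \<exists>S\<in>\<S>. S \<subseteq> keys t}"

lemma mono_idealD: "p \<in> mono_ideal \<S> \<Longrightarrow> t \<in> keys p \<Longrightarrow> \<exists>S\<in>\<S>. S \<subseteq> keys t"
  by (auto simp: mono_ideal_def)

lemma mono_ideal_mult:
  assumes a: "a \<in> mono_ideal \<S>" shows "r * a \<in> mono_ideal \<S>"
  unfolding mono_ideal_def
proof (intro CollectI ballI)
  fix t assume "t \<in> keys (r * a)"
  then obtain s1 s2 where t: "t = s1 + s2" "s2 \<in> keys a"
    using keys_mult[of r a] by auto
  obtain S where "S \<in> \<S>" "S \<subseteq> keys s2" using mono_idealD[OF a t(2)] by auto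
  then show "\<exists>S\<in>\<S>. S \<subseteq> keys t"
    by (auto simp: t keys_add_nat)
qed

lemma is_ideal_mono_ideal: "is_ideal (mono_ideal \<S>)"
  unfolding is_ideal_def
proof (intro conjI ballI allI)
  show "0 \<in> mono_ideal \<S>" by (simp add: mono_ideal_def)
  show "a + b \<in> mono_ideal \<S>" if "a \<in> mono_ideal \<S>" "b \<in> mono_ideal \<S>" for a b
  proof -
    have "t \<in> keys a \<or> t \<in> keys b" if "t \<in> keys (a + b)" for t
      using keys_add[of a b] that by auto
    then show ?thesis using that unfolding mono_ideal_def by blast
  qed
qed (rule mono_ideal_mult)

lemma single_in_mono_ideal:
  "a \<noteq> 0 \<Longrightarrow> single t a \<in> mono_ideal \<S> \<longleftrightarrow> (\<exists>S\<in>\<S>. S \<subseteq> keys t)"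
  by (simp add: mono_ideal_def)

lemma sqf_monomial_in_mono_ideal:
  "sqf_monomial T \<in> mono_ideal \<S> \<longleftrightarrow> (\<exists>S\<in>\<S>. S \<subseteq> (T :: 'v::finite set))"
  by (simp add: sqf_monomial_eq_single single_in_mono_ideal)

lemma single_factor_sqf_monomial:
  fixes S :: "'v::finite set"
  assumes "S \<subseteq> keys t"
  shows "single t a = single (t - expo S) a * sqf_monomial S"
proof -
  have "t = t - expo S + expo S"
    using assms by (intro poly_mapping_eqI) (auto simp: lookup_add lookup_minus lookup_expo in_keys_iff)
  then show ?thesis by (simp add: sqf_monomial_eq_single mult_single)
qed

lemma ideal_gen_sqf_monomial:
  "ideal_gen (sqf_monomial ` \<S>) = (mono_ideal \<S> :: ('v::finite, 'k::comm_ring_1) mpoly set)"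
proof
  show "ideal_gen (sqf_monomial ` \<S>) \<subseteq> (mono_ideal \<S> :: ('v, 'k) mpoly set)"
    by (intro ideal_gen_subset is_ideal_mono_ideal) (auto simp: sqf_monomial_in_mono_ideal)
next
  show "(mono_ideal \<S> :: ('v, 'k) mpoly set) \<subseteq> ideal_gen (sqf_monomial ` \<S>)"
  proof
    fix p :: "('v, 'k) mpoly" assume p: "p \<in> mono_ideal \<S>"
    have "single t (lookup p t) \<in> ideal_gen (sqf_monomial ` \<S>)"
      if "t \<in> keys p" for t
    proof -
      obtain S where "S \<in> \<S>" "S \<subseteq> keys t" using mono_idealD[OF p \<open>t \<in> keys p\<close>] by auto
      then show ?thesis
        by (subst single_factor_sqf_monomial)
          (auto intro: is_ideal_mult[OF is_ideal_ideal_gen] ideal_gen_superset)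
    qed
    then have "(\<Sum>t\<in>keys p. single t (lookup p t)) \<in> ideal_gen (sqf_monomial ` \<S>)"
      by (intro is_ideal_sum is_ideal_ideal_gen)
    then show "p \<in> ideal_gen (sqf_monomial ` \<S>)" by (simp add: poly_mapping_sum_single)
  qed
qed

lemma sqf_ideal_eq_mono_ideal: "sqf_ideal ms \<mu> = mono_ideal (ms ` {1..\<mu>})"
  for ms :: "nat \<Rightarrow> 'v::finite set"
  by (simp add: sqf_ideal_def ideal_gen_sqf_monomial)

text \<open>Multiplication by a monomial shifts exponents without cancellation, and a set lies in
  \<open>keys t \<union> T\<close> exactly when its part outside \<open>T\<close> lies in
  \<open>keys t\<close>. This computes colon ideals generator by generator.\<close>

lemma mono_ideal_mult_sqf_monomial:
  fixes T :: "'v::finite set"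
  shows "p * sqf_monomial T \<in> mono_ideal \<S> \<longleftrightarrow> p \<in> mono_ideal ((\<lambda>S. S - T) ` \<S>)"
  by (simp add: mono_ideal_def sqf_monomial_eq_single keys_mult_single keys_add_nat
      Diff_subset_conv Un_commute[of T])

lemma mono_ideal_empty [simp]: "mono_ideal {} = {0}"
  by (auto simp: mono_ideal_def)

lemma mono_ideal_antimono:
  "(\<And>S. S \<in> \<S> \<Longrightarrow> \<exists>T\<in>\<T>. T \<subseteq> S) \<Longrightarrow> mono_ideal \<S> \<subseteq> mono_ideal \<T>"
  by (auto simp: mono_ideal_def) (meson order_trans)

text \<open>Brings the ideal into the shape J + (m), both for adding a generator to a resolution and
  for dividing by the next variable of a regular sequence. The right-hand side is an ideal that
  contains all generators.\<close>

lemma mono_ideal_insert: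
  fixes T :: "'v::finite set"
  shows "(mono_ideal (insert T \<S>) :: ('v, 'k::comm_ring_1) mpoly set) = {a + r * sqf_monomial T | a r. a \<in> mono_ideal \<S>}" (is "_ = ?L")
proof
  show "?L \<subseteq> mono_ideal (insert T \<S>)"
  proof
    fix x assume "x \<in> ?L"
    then obtain a r where "x = a + r * sqf_monomial T" "a \<in> mono_ideal \<S>" by auto
    moreover have "mono_ideal \<S> \<subseteq> (mono_ideal (insert T \<S>) :: ('v, 'k) mpoly set)"
      by (rule mono_ideal_antimono) auto
    ultimately show "x \<in> mono_ideal (insert T \<S>)"
      by (auto intro!: is_ideal_add is_ideal_mult is_ideal_mono_ideal simp: sqf_monomial_in_mono_ideal)
  qed
next
  have "is_ideal ?L"
    unfolding is_ideal_def
  proof (intro conjI ballI allI)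
    show "0 \<in> ?L"
      by (intro CollectI exI[of _ 0]) (auto simp: is_ideal_zero is_ideal_mono_ideal)
  next
    fix x y assume "x \<in> ?L" "y \<in> ?L"
    then obtain a r b s where *: "x = a + r * sqf_monomial T" "a \<in> mono_ideal \<S>"
      "y = b + s * sqf_monomial T" "b \<in> mono_ideal \<S>" by auto
    then have "x + y = (a + b) + (r + s) * sqf_monomial T" by (simp add: algebra_simps)
    moreover have "a + b \<in> mono_ideal \<S>" by (intro is_ideal_add is_ideal_mono_ideal *)
    ultimately show "x + y \<in> ?L" by (intro CollectI exI conjI)
  next
    fix t x assume "x \<in> ?L"
    then obtain a r where *: "x = a + r * sqf_monomial T" "a \<in> mono_ideal \<S>" by auto
    then have "t * x = t * a + (t * r) * sqf_monomial T" by (simp add: algebra_simps)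
    moreover have "t * a \<in> mono_ideal \<S>" by (intro is_ideal_mult is_ideal_mono_ideal *)
    ultimately show "t * x \<in> ?L" by (intro CollectI exI conjI)
  qed
  moreover have "sqf_monomial ` insert T \<S> \<subseteq> ?L"
  proof
    fix x :: "('v, 'k) mpoly"
    assume "x \<in> sqf_monomial ` insert T \<S>"
    then consider "x = 0 + 1 * sqf_monomial T"
      | S where "S \<in> \<S>" "x = sqf_monomial S + 0 * sqf_monomial T" by auto
    then show "x \<in> ?L"
    proof cases
      case 1
      then show ?thesis using is_ideal_zero[OF is_ideal_mono_ideal] by (intro CollectI exI conjI)
    next
      case 2
      then have "sqf_monomial S \<in> (mono_ideal \<S> :: ('v, 'k) mpoly set)"
        by (auto simp: sqf_monomial_in_mono_ideal)
      with 2 show ?thesis by (intro CollectI exI conjI)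
    qed
  qed
  ultimately show "mono_ideal (insert T \<S>) \<subseteq> ?L"
    unfolding ideal_gen_sqf_monomial[symmetric] by (rule ideal_gen_subset)
qed

subsection \<open>Constructing free resolutions\<close>

text \<open>Generators are sequences without a prescribed ambient rank, and \<open>comb\<close> does
  not cut off its values. Hence modules of iterated syzygies can be formed without recording in
  which free module they lie.\<close>

definition comb :: "nat \<Rightarrow> (nat \<Rightarrow> nat \<Rightarrow> ('v, 'k::comm_ring_1) mpoly) \<Rightarrow> (nat \<Rightarrow> ('v, 'k) mpoly) \<Rightarrow> nat \<Rightarrow> ('v, 'k) mpoly"
  where "comb c g x = (\<lambda>r. \<Sum>k<c. x k * g k r)"

definition syz :: "nat \<Rightarrow> (nat \<Rightarrow> nat \<Rightarrow> ('v, 'k::comm_ring_1) mpoly) \<Rightarrow> (nat \<Rightarrow> ('v, 'k) mpoly) set"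
  where "syz c g = {x \<in> free_mod c. comb c g x = 0}"

text \<open>\<open>resolvable p M\<close> says that the submodule \<open>M\<close> of a free module has projective dimension
  less than \<open>p\<close>, so that for an ideal \<open>I\<close> it bounds the projective dimension of \<open>R/I\<close> by \<open>p\<close>.\<close>

primrec resolvable :: "nat \<Rightarrow> (nat \<Rightarrow> ('v, 'k::comm_ring_1) mpoly) set \<Rightarrow> bool" where
  "resolvable 0 M = (M = {0})"
| "resolvable (Suc p) M = (\<exists>c g. M = comb c g ` free_mod c \<and> resolvable p (syz c g))"

definition submodule :: "(nat \<Rightarrow> ('v, 'k::comm_ring_1) mpoly) set \<Rightarrow> bool" where
  "submodule Y \<longleftrightarrow> 0 \<in> Y \<and> (\<forall>x\<in>Y. \<forall>y\<in>Y. x + y \<in> Y) \<and> (\<forall>a. \<forall>x\<in>Y. (\<lambda>k. a * x k) \<in> Y)"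

lemma submodule_zero: "submodule Y \<Longrightarrow> 0 \<in> Y"
  and submodule_add: "submodule Y \<Longrightarrow> x \<in> Y \<Longrightarrow> y \<in> Y \<Longrightarrow> x + y \<in> Y"
  and submodule_smult: "submodule Y \<Longrightarrow> x \<in> Y \<Longrightarrow> (\<lambda>k. a * x k) \<in> Y"
  by (auto simp: submodule_def)

lemma submodule_uminus: "submodule Y \<Longrightarrow> x \<in> Y \<Longrightarrow> - x \<in> Y"
  using submodule_smult[of Y x "-1"] by (simp add: fun_Compl_def)

lemma submodule_diff: "submodule Y \<Longrightarrow> x \<in> Y \<Longrightarrow> y \<in> Y \<Longrightarrow> x - y \<in> Y"
  using submodule_add[of Y x "- y"] submodule_uminus[of Y y] by simp

lemma comb_add: "comb c g (x + y) = comb c g x + comb c g y"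
  by (rule ext) (simp add: comb_def distrib_right sum.distrib)

lemma comb_smult: "comb c g (\<lambda>k. a * x k) = (\<lambda>r. a * comb c g x r)"
  by (rule ext) (simp add: comb_def sum_distrib_left mult.assoc)

lemma comb_zero [simp]: "comb c g 0 = 0"
  by (rule ext) (simp add: comb_def)

lemma comb_uminus: "comb c g (- x) = - comb c g x"
  by (rule ext) (simp add: comb_def sum_negf)

lemma comb_cong: "(\<And>k. k < c \<Longrightarrow> x k = y k) \<Longrightarrow> comb c g x = comb c g y"
  by (rule ext) (simp add: comb_def)

lemma comb_in_submodule:
  assumes "submodule Y" "\<And>k. k < c \<Longrightarrow> g k \<in> Y" shows "comb c g x \<in> Y"
  using assms(2)
proof (induction c)
  case 0
  then show ?case using submodule_zero[OF assms(1)] by (simp add: comb_def zero_fun_def)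
next
  case (Suc c)
  have "comb (Suc c) g x = comb c g x + (\<lambda>r. x c * g c r)"
    by (rule ext) (simp add: comb_def)
  moreover have "comb c g x \<in> Y" "g c \<in> Y" using Suc by auto
  ultimately show ?case using submodule_add[OF assms(1) _ submodule_smult[OF assms(1)]] by metis
qed

lemma comb_in_range: "comb c g x \<in> comb c g ` free_mod c"
proof -
  have "comb c g x = comb c g (\<lambda>k. if k < c then x k else 0)" by (rule comb_cong) simp
  then show ?thesis by (auto simp: free_mod_def)
qed

lemma comb_unit: "j < c \<Longrightarrow> comb c g (\<lambda>k. if k = j then 1 else 0) = g j"
  by (rule ext) (simp add: comb_def if_distrib[of "\<lambda>a. a * _"] cong: if_cong)

lemma gen_in_range: "j < c \<Longrightarrow> g j \<in> comb c g ` free_mod c"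
  using comb_in_range[of c g "\<lambda>k. if k = j then 1 else 0"] by (simp add: comb_unit)

lemma free_mod_zero_eq [simp]: "free_mod 0 = {0}"
  by (auto simp: free_mod_def)

lemma submodule_syz: "submodule (syz c g)"
  by (auto simp: submodule_def syz_def free_mod_def comb_add comb_smult)

lemma sum_lessThan_add: "(\<Sum>k<a + b. f k) = (\<Sum>k<a. f k) + (\<Sum>k<b. f (a + k))"
  for a b :: nat and f :: "nat \<Rightarrow> 'a::comm_monoid_add"
  by (induction b) (auto simp: add.assoc)

lemma comb_append:
  "comb (a + b) (\<lambda>k. if k < a then g k else h (k - a)) x = comb a g x + comb b h (\<lambda>k. x (a + k))"
  by (rule ext) (simp add: comb_def sum_lessThan_add)

lemma comb_append_glue:
  "comb (a + b) (\<lambda>k. if k < a then g k else h (k - a)) (\<lambda>k. if k < a then w k else z (k - a))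
    = comb a g w + comb b h z"
proof -
  have "comb a g (\<lambda>k. if k < a then w k else z (k - a)) = comb a g w" by (rule comb_cong) simp
  then show ?thesis by (simp add: comb_append)
qed

lemma glue_in_free_mod: "z \<in> free_mod b \<Longrightarrow> (\<lambda>k. if k < a then w k else z (k - a)) \<in> free_mod (a + b)"
  by (auto simp: free_mod_def)

lemma resolvable_Suc: "resolvable p M \<Longrightarrow> resolvable (Suc p) M"
proof (induction p arbitrary: M)
  case 0
  have "comb 0 g ` free_mod 0 = {0}" "syz 0 g = {0}" for g :: "nat \<Rightarrow> nat \<Rightarrow> ('a, 'b) mpoly"
    by (auto simp: syz_def)
  with 0 show ?case by (metis resolvable.simps)
next
  case (Suc p)
  then show ?case by (metis resolvable.simps(2))
qed

lemma resolvable_mono: "p \<le> q \<Longrightarrow> resolvable p M \<Longrightarrow> resolvable q M"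
  by (induction rule: dec_induct) (auto simp del: resolvable.simps intro: resolvable_Suc)

text \<open>The horseshoe lemma for the projection of \<open>Y\<close> to the coordinates from \<open>c\<close> on.\<close>

lemma resolvable_extension:
  assumes "submodule Y" "resolvable p {y \<in> Y. \<forall>k\<ge>c. y k = 0}" "resolvable p ((\<lambda>y k. y (c + k)) ` Y)"
  shows "resolvable p Y"
  using assms
proof (induction p arbitrary: c Y)
  case 0
  have "y = 0" if "y \<in> Y" for y
  proof -
    have "(\<lambda>k. y (c + k)) = 0" using 0(3) that by auto
    then have "\<forall>k\<ge>c. y k = 0" by (metis le_add_diff_inverse zero_fun_apply)
    then show ?thesis using 0(2) that by auto
  qed
  then show ?case using submodule_zero[OF 0(1)] by auto
next
  case (Suc p)
  let ?X = "{y \<in> Y. \<forall>k\<ge>c. y k = 0}"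
  let ?sh = "\<lambda>c y k. y (c + k)"
  obtain a g where X: "?X = comb a g ` free_mod a" and rX: "resolvable p (syz a g)"
    using Suc.prems(2) by auto
  obtain b g' where Z: "?sh c ` Y = comb b g' ` free_mod b" and rZ: "resolvable p (syz b g')"
    using Suc.prems(3) by auto
  have "\<forall>k. \<exists>y. k < b \<longrightarrow> y \<in> Y \<and> ?sh c y = g' k"
  proof
    fix k
    show "\<exists>y. k < b \<longrightarrow> y \<in> Y \<and> ?sh c y = g' k"
    proof (cases "k < b")
      case True
      then have "g' k \<in> ?sh c ` Y" unfolding Z by (rule gen_in_range)
      then obtain y where "g' k = ?sh c y" "y \<in> Y" by (rule imageE)
      then show ?thesis by (intro exI[of _ y]) simp
    qed simp
  qed
  from choice[OF this] obtain h where h': "\<forall>k. k < b \<longrightarrow> h k \<in> Y \<and> ?sh c (h k) = g' k" ..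
  have h: "h k \<in> Y" "?sh c (h k) = g' k" if "k < b" for k using h' that by simp_all
  \<comment> \<open>Generators of the kernel of the projection, followed by lifts of generators of
    its image.\<close>
  define G where "G = (\<lambda>k. if k < a then g k else h (k - a))"
  have sh_h: "?sh c (comb b h z) = comb b g' z" for z
    using h(2) by (auto simp: comb_def fun_eq_iff)
  have hY: "comb b h z \<in> Y" for z by (intro comb_in_submodule Suc.prems h)
  have gX: "comb a g w \<in> ?X" for w unfolding X by (rule comb_in_range)
  have X_I: "y \<in> ?X" if "y \<in> Y" "?sh c y = 0" for y
  proof -
    have "y k = 0" if "c \<le> k" for k
      using fun_cong[OF \<open>?sh c y = 0\<close>, of "k - c"] that by simp
    then show ?thesis using that by auto
  qed
  have Y: "Y = comb (a + b) G ` free_mod (a + b)"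
  proof (intro equalityI subsetI)
    fix y assume y: "y \<in> Y"
    then obtain z where z: "z \<in> free_mod b" "?sh c y = comb b g' z" using Z by blast
    have "?sh c (y - comb b h z) = ?sh c y - ?sh c (comb b h z)" by (simp add: fun_eq_iff)
    then have "y - comb b h z \<in> ?X"
      using y z hY Suc.prems(1) by (intro X_I submodule_diff) (auto simp: sh_h)
    then obtain w where "y - comb b h z = comb a g w" unfolding X by auto
    then have "y = comb a g w + comb b h z" by (simp add: diff_eq_eq)
    then show "y \<in> comb (a + b) G ` free_mod (a + b)"
      unfolding G_def comb_append_glue[symmetric] by (rule image_eqI[OF _ glue_in_free_mod[OF z(1)]])
  next
    fix y assume "y \<in> comb (a + b) G ` free_mod (a + b)"
    then obtain x where x: "y = comb a g x + comb b h (?sh a x)"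
      unfolding G_def comb_append by auto
    have "comb a g x \<in> Y" using gX by simp
    then show "y \<in> Y" unfolding x by (intro submodule_add Suc.prems hY)
  qed
  have G: "comb (a + b) G x = comb a g x + comb b h (?sh a x)" for x
    by (simp add: G_def comb_append)
  \<comment> \<open>The syzygies of \<open>G\<close> are again an extension: those supported on the
    first \<open>a\<close> coordinates are \<open>syz a g\<close>, and the remaining coordinates run
    through \<open>syz b g'\<close>. The induction hypothesis applies with \<open>a\<close> in the
    role of \<open>c\<close>.\<close>
  have "{x \<in> syz (a + b) G. \<forall>k\<ge>a. x k = 0} = syz a g"
  proof (intro equalityI subsetI)
    fix x assume "x \<in> {x \<in> syz (a + b) G. \<forall>k\<ge>a. x k = 0}"
    then have *: "comb a g x + comb b h (?sh a x) = 0" "\<forall>k\<ge>a. x k = 0" by (auto simp: syz_def G)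
    moreover from *(2) have "?sh a x = 0" by (simp add: fun_eq_iff)
    ultimately show "x \<in> syz a g" by (simp add: syz_def free_mod_def)
  next
    fix x assume "x \<in> syz a g"
    then have *: "comb a g x = 0" "\<forall>k\<ge>a. x k = 0" by (auto simp: syz_def free_mod_def)
    moreover from *(2) have "?sh a x = 0" by (simp add: fun_eq_iff)
    ultimately show "x \<in> {x \<in> syz (a + b) G. \<forall>k\<ge>a. x k = 0}" by (simp add: syz_def G free_mod_def)
  qed
  moreover have "?sh a ` syz (a + b) G = syz b g'"
  proof (intro equalityI subsetI)
    fix z assume "z \<in> ?sh a ` syz (a + b) G"
    then obtain x where x: "x \<in> free_mod (a + b)" "comb a g x + comb b h z = 0" "z = ?sh a x"
      by (auto simp: syz_def G)
    have "comb b h z = comb a g (- x)"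
      using x(2) by (simp add: comb_uminus add_eq_0_iff)
    then have "comb b h z \<in> ?X" by (simp only: gX)
    then have "?sh c (comb b h z) = 0" by (auto simp: fun_eq_iff)
    then show "z \<in> syz b g'" using x by (auto simp: syz_def sh_h free_mod_def)
  next
    fix z assume z: "z \<in> syz b g'"
    then have "?sh c (comb b h z) = 0" by (simp add: sh_h syz_def)
    then have "comb b h z \<in> ?X" using hY by (intro X_I)
    then obtain w where w: "comb b h z = comb a g w" unfolding X by auto
    \<comment> \<open>A syzygy of the projected generators lifts to an element of the kernel part,
      not to zero; the coefficients \<open>- w\<close> cancel this defect.\<close>
    let ?x = "\<lambda>k. if k < a then (- w) k else z (k - a)"
    have "comb (a + b) G ?x = 0"
      unfolding G_def comb_append_glue w by (simp add: comb_uminus)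
    moreover have "?x \<in> free_mod (a + b)" using z by (intro glue_in_free_mod) (simp add: syz_def)
    ultimately have "?x \<in> syz (a + b) G" by (simp add: syz_def)
    moreover have "z = ?sh a ?x" by (simp add: fun_eq_iff)
    ultimately show "z \<in> ?sh a ` syz (a + b) G" by (intro image_eqI)
  qed
  ultimately have "resolvable p (syz (a + b) G)"
    using Suc.IH[OF submodule_syz, of "a + b" G a] rX rZ by (simp only:)
  with Y show ?case unfolding resolvable.simps by (intro exI conjI)
qed

definition ideal_vec :: "('v, 'k::comm_ring_1) mpoly set \<Rightarrow> (nat \<Rightarrow> ('v, 'k) mpoly) set" where
  "ideal_vec J = {x \<in> free_mod 1. x 0 \<in> J}"

lemma ideal_vec_zero: "ideal_vec {0} = {0}"
proof -
  have "x k = 0" if "x \<in> ideal_vec {0}" for x and k :: nat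
    using that by (cases k) (auto simp: ideal_vec_def free_mod_def)
  then have "ideal_vec {0} \<subseteq> {0}" by (auto simp: fun_eq_iff)
  moreover have "0 \<in> ideal_vec {0}" by (simp add: ideal_vec_def free_mod_def)
  ultimately show ?thesis by auto
qed

text \<open>The syzygies of generators of \<open>J\<close> together with \<open>m\<close> are an extension of the colon ideal
  \<open>J : m\<close> by the syzygies of the generators of \<open>J\<close>.\<close>

lemma resolvable_add_generator:
  assumes J: "is_ideal J" and r1: "resolvable (Suc p) (ideal_vec J)"
    and r2: "resolvable p (ideal_vec {a. a * m \<in> J})"
  shows "resolvable (Suc p) (ideal_vec {a + r * m | a r. a \<in> J})"
proof -
  obtain c g where JJ: "ideal_vec J = comb c g ` free_mod c" and r: "resolvable p (syz c g)"
    using r1 by auto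
  define e :: "('a, 'b) mpoly \<Rightarrow> nat \<Rightarrow> ('a, 'b) mpoly"
    where "e = (\<lambda>y r. if r = 0 then y else 0)"
  have e_inj: "y = y'" if "e y = e y'" for y y' using fun_cong[OF that, of 0] by (simp add: e_def)
  have ideal_vec_e: "ideal_vec A = e ` A" for A
  proof (intro equalityI subsetI)
    fix x assume "x \<in> ideal_vec A"
    then have "x = e (x 0)" "x 0 \<in> A" by (auto simp: ideal_vec_def e_def free_mod_def fun_eq_iff)
    then show "x \<in> e ` A" by (rule image_eqI)
  qed (auto simp: ideal_vec_def e_def free_mod_def)
  have e_add: "e y + e y' = e (y + y')" for y y' by (auto simp: e_def)
  define G where "G = (\<lambda>k. if k < c then g k else (\<lambda>_. e m) (k - c))"
  have G: "comb (c + 1) G x = comb c g x + e (x c * m)" for x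
    unfolding G_def comb_append by (auto simp: comb_def e_def fun_eq_iff)
  have gJ: "\<exists>a\<in>J. comb c g x = e a" for x
    using comb_in_range[of c g x] unfolding JJ[symmetric] ideal_vec_e by auto
  have Jg: "\<exists>w\<in>free_mod c. comb c g w = e a" if "a \<in> J" for a
  proof -
    have "e a \<in> comb c g ` free_mod c" unfolding JJ[symmetric] ideal_vec_e using that by (rule imageI)
    then show ?thesis by auto
  qed
  have "ideal_vec {a + r * m | a r. a \<in> J} = comb (c + 1) G ` free_mod (c + 1)"
  proof (intro equalityI subsetI)
    fix y assume "y \<in> ideal_vec {a + r * m | a r. a \<in> J}"
    then obtain a r where a: "a \<in> J" "y = e (a + r * m)" by (auto simp: ideal_vec_e)
    obtain w where w: "w \<in> free_mod c" "comb c g w = e a" using Jg a by auto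
    let ?x = "w(c := r)"
    have "comb c g ?x = comb c g w" by (rule comb_cong) simp
    then have "y = comb (c + 1) G ?x" unfolding G by (simp add: w a e_add)
    moreover have "?x \<in> free_mod (c + 1)" using w by (auto simp: free_mod_def)
    ultimately show "y \<in> comb (c + 1) G ` free_mod (c + 1)" by (rule image_eqI)
  next
    fix y assume "y \<in> comb (c + 1) G ` free_mod (c + 1)"
    then obtain x where "y = comb c g x + e (x c * m)" unfolding G by auto
    moreover obtain a where "a \<in> J" "comb c g x = e a" using gJ by blast
    ultimately show "y \<in> ideal_vec {a + r * m | a r. a \<in> J}" by (auto simp: ideal_vec_e e_add)
  qed
  moreover have "resolvable p (syz (c + 1) G)"
  proof (rule resolvable_extension[where c = c])
    have "{x \<in> syz (c + 1) G. \<forall>k\<ge>c. x k = 0} = syz c g"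
      unfolding syz_def G by (auto simp: free_mod_def e_def fun_eq_iff)
    then show "resolvable p {x \<in> syz (c + 1) G. \<forall>k\<ge>c. x k = 0}" using r by simp
    have "(\<lambda>y k. y (c + k)) ` syz (c + 1) G = ideal_vec {a. a * m \<in> J}"
    proof (intro equalityI subsetI)
      fix z assume "z \<in> (\<lambda>y k. y (c + k)) ` syz (c + 1) G"
      then obtain x where x: "x \<in> free_mod (c + 1)" "comb c g x + e (x c * m) = 0" "z = (\<lambda>k. x (c + k))"
        unfolding syz_def G by auto
      obtain a where a: "a \<in> J" "comb c g x = e a" using gJ by blast
      then have "e (a + x c * m) = e 0" using x(2) by (simp add: e_add) (simp add: e_def fun_eq_iff)
      then have "x c * m = - a" using e_inj[of "a + x c * m" 0] by (simp add: add_eq_0_iff)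
      then show "z \<in> ideal_vec {a. a * m \<in> J}"
        using x a J by (auto simp: ideal_vec_def free_mod_def is_ideal_uminus)
    next
      fix z assume z: "z \<in> ideal_vec {a. a * m \<in> J}"
      then have "- (z 0 * m) \<in> J" using J by (auto simp: ideal_vec_def is_ideal_uminus)
      then obtain w where w: "w \<in> free_mod c" "comb c g w = e (- (z 0 * m))" using Jg by blast
      let ?x = "w(c := z 0)"
      have "comb c g ?x = comb c g w" by (rule comb_cong) simp
      then have "comb (c + 1) G ?x = 0" unfolding G by (simp add: w e_add) (simp add: e_def fun_eq_iff)
      moreover have "?x \<in> free_mod (c + 1)" using w by (auto simp: free_mod_def)
      ultimately have "?x \<in> syz (c + 1) G" by (simp add: syz_def)
      moreover have "z = (\<lambda>k. ?x (c + k))"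
        using z w by (auto simp: ideal_vec_def free_mod_def fun_eq_iff)
      ultimately show "z \<in> (\<lambda>y k. y (c + k)) ` syz (c + 1) G" by (intro image_eqI)
    qed
    then show "resolvable p ((\<lambda>y k. y (c + k)) ` syz (c + 1) G)" using r2 by simp
  qed (rule submodule_syz)
  ultimately show ?thesis unfolding resolvable.simps by (intro exI conjI)
qed

text \<open>Colons of squarefree monomial ideals by squarefree monomials are of the same kind, so an
  induction on generators never leaves families of sets.\<close>

lemma resolvable_mono_ideal_insert:
  fixes T :: "'v::finite set"
  assumes "resolvable (Suc p) (ideal_vec (mono_ideal \<S> :: ('v, 'k::comm_ring_1) mpoly set))"
    and "resolvable p (ideal_vec (mono_ideal ((\<lambda>S. S - T) ` \<S>) :: ('v, 'k) mpoly set))"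
  shows "resolvable (Suc p) (ideal_vec (mono_ideal (insert T \<S>) :: ('v, 'k) mpoly set))"
  unfolding mono_ideal_insert
  by (rule resolvable_add_generator[OF is_ideal_mono_ideal assms(1)])
    (simp add: mono_ideal_mult_sqf_monomial assms(2))

section \<open>From iterated syzygies to exact sequences of matrices\<close>

definition resolves :: "(nat \<Rightarrow> ('v, 'k::comm_ring_1) mpoly) set \<Rightarrow> nat \<Rightarrow> (nat \<Rightarrow> nat)
    \<Rightarrow> (nat \<Rightarrow> nat \<Rightarrow> nat \<Rightarrow> ('v, 'k) mpoly) \<Rightarrow> bool" where
  "resolves M p b d \<longleftrightarrow>
     (if p = 0 then M = {0} else M = matapp (d 1) (b 0) (b 1) ` free_mod (b 1)) \<and>
     (\<forall>i. 0 < i \<and> i < p \<longrightarrow>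
        {x\<in>free_mod (b i). matapp (d i) (b (i-1)) (b i) x = (\<lambda>_. 0)}
          = matapp (d (i+1)) (b i) (b (i+1)) ` free_mod (b (i+1))) \<and>
     (0 < p \<longrightarrow> (\<forall>x\<in>free_mod (b p). matapp (d p) (b (p-1)) (b p) x = (\<lambda>_. 0) \<longrightarrow> x = (\<lambda>_. 0)))"

lemma resolvable_imp_resolves:
  assumes "resolvable p M" "M \<subseteq> free_mod m"
  shows "\<exists>b d. b 0 = m \<and> resolves M p b d"
  using assms
proof (induction p arbitrary: M m)
  case 0
  then show ?case by (auto simp: resolves_def)
next
  case (Suc p)
  obtain c g where M: "M = comb c g ` free_mod c" and r: "resolvable p (syz c g)"
    using Suc.prems by auto
  have "syz c g \<subseteq> free_mod c" by (auto simp: syz_def)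
  from Suc.IH[OF r this] obtain b d where b0: "b 0 = c" and bd: "resolves (syz c g) p b d"
    by blast
  have ex1: "if p = 0 then syz c g = {0} else syz c g = matapp (d 1) (b 0) (b 1) ` free_mod (b 1)"
    and exi: "\<And>i. 0 < i \<Longrightarrow> i < p \<Longrightarrow>
        {x\<in>free_mod (b i). matapp (d i) (b (i-1)) (b i) x = (\<lambda>_. 0)}
          = matapp (d (i+1)) (b i) (b (i+1)) ` free_mod (b (i+1))"
    and exp: "0 < p \<Longrightarrow> (\<forall>x\<in>free_mod (b p). matapp (d p) (b (p-1)) (b p) x = (\<lambda>_. 0) \<longrightarrow> x = (\<lambda>_. 0))"
    using bd by (simp_all add: resolves_def)
  \<comment> \<open>The complex of the first syzygy module moves up by one place, and the generators
    of \<open>M\<close> become the columns of the new first matrix.\<close>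
  define b' where "b' = case_nat m b"
  define d' where "d' = (\<lambda>i. if i = 1 then (\<lambda>r k. g k r) else d (i - 1))"
  \<comment> \<open>\<open>matapp\<close> cuts its values off at \<open>m\<close> while
    \<open>comb\<close> does not; the two agree because the generators lie in
    \<open>free_mod m\<close>.\<close>
  have g0: "g k r = 0" if "k < c" "m \<le> r" for k r
    using gen_in_range[OF that(1), of g] Suc.prems(2) that(2) unfolding M[symmetric]
    by (auto simp: free_mod_def)
  have mat1: "matapp (\<lambda>r k. g k r) m c x = comb c g x" for x
    using g0 by (auto simp: matapp_def comb_def fun_eq_iff mult.commute)
  have b': "b' 0 = m" "b' 1 = c" "\<And>i. b' (Suc i) = b i" by (simp_all add: b'_def b0)
  have syz: "{x \<in> free_mod c. matapp (d' 1) (b' 0) (b' 1) x = (\<lambda>_. 0)} = syz c g"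
    unfolding b' by (simp add: syz_def d'_def mat1 zero_fun_def)
  have "resolves M (Suc p) b' d'"
    unfolding resolves_def
  proof (intro conjI allI impI)
    show "if Suc p = 0 then M = {0} else M = matapp (d' 1) (b' 0) (b' 1) ` free_mod (b' 1)"
      unfolding b' by (simp add: d'_def M mat1)
  next
    fix i assume i: "0 < i \<and> i < Suc p"
    show "{x \<in> free_mod (b' i). matapp (d' i) (b' (i - 1)) (b' i) x = (\<lambda>_. 0)} =
         matapp (d' (i + 1)) (b' i) (b' (i + 1)) ` free_mod (b' (i + 1))"
    proof (cases "i = 1")
      case True
      have "b' (Suc (Suc 0)) = b 1" by (simp add: b')
      then show ?thesis using syz ex1 i True b0 by (simp add: b' d'_def)
    next
      case False
      then have "i = Suc (Suc (i - 2))" using i by linarith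
      then obtain k where k: "i = Suc (Suc k)" ..
      with i exi[of "Suc k"] show ?thesis by (simp add: b' d'_def)
    qed
  next
    show "\<forall>x\<in>free_mod (b' (Suc p)). matapp (d' (Suc p)) (b' (Suc p - 1)) (b' (Suc p)) x = (\<lambda>_. 0) \<longrightarrow> x = (\<lambda>_. 0)"
    proof (cases p)
      case 0
      with syz ex1 b0 show ?thesis by (auto simp: b' zero_fun_def)
    next
      case (Suc k)
      with exp show ?thesis by (simp add: b' d'_def)
    qed
  qed
  then show ?case using b' by blast
qed

lemma resolvable_imp_free_resolution:
  assumes "resolvable p (ideal_vec I)" "is_ideal I"
  shows "\<exists>b d e. is_free_resolution I p b d e"
proof -
  have "ideal_vec I \<subseteq> free_mod 1" by (auto simp: ideal_vec_def)
  from resolvable_imp_resolves[OF assms(1) this] obtain b d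
    where b0: "b 0 = 1" and bd: "resolves (ideal_vec I) p b d" by blast
  have ker: "{x \<in> free_mod (b 0). (\<Sum>k<b 0. x k * 1) \<in> I} = ideal_vec I" by (simp add: ideal_vec_def b0)
  have "(\<lambda>k. if k = 0 then f else 0) \<in> free_mod (b 0)"
    "f - (\<Sum>k<b 0. (if k = 0 then f else 0) * 1) \<in> I" for f
    using is_ideal_zero[OF assms(2)] by (auto simp: b0 free_mod_def)
  then have surj: "\<exists>x\<in>free_mod (b 0). f - (\<Sum>k<b 0. x k * 1) \<in> I" for f
    by (intro bexI)
  have "\<forall>x\<in>free_mod (b 0). (\<Sum>k<b 0. x k * 1) \<in> I \<longrightarrow> x = (\<lambda>_. 0)" if "p = 0"
    using that bd ker by (auto simp: resolves_def zero_fun_def)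
  then have ex0: "if p = 0 then \<forall>x\<in>free_mod (b 0). (\<Sum>k<b 0. x k * 1) \<in> I \<longrightarrow> x = (\<lambda>_. 0)
      else {x \<in> free_mod (b 0). (\<Sum>k<b 0. x k * 1) \<in> I} = matapp (d 1) (b 0) (b 1) ` free_mod (b 1)"
    unfolding ker using bd[unfolded resolves_def, THEN conjunct1] by (cases "p = 0") simp_all
  have "is_free_resolution I p b d (\<lambda>_. 1)"
    unfolding is_free_resolution_def
    by (intro conjI[OF allI[OF surj] conjI[OF ex0]] bd[unfolded resolves_def, THEN conjunct2])
  then show ?thesis by blast
qed

subsection \<open>Strings\<close>

text \<open>\<open>opn i\<close> says that the inner vertex \<open>i\<close> is open. The two end vertices of a string are closed.\<close>

fun string_rank :: "(nat \<Rightarrow> bool) \<Rightarrow> nat \<Rightarrow> nat" where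
  "string_rank opn 0 = 0"
| "string_rank opn (Suc 0) = 1"
| "string_rank opn (Suc (Suc 0)) = 2"
| "string_rank opn (Suc (Suc (Suc j))) =
    (if opn (j + 2) then string_rank opn j + 2 else string_rank opn (Suc (Suc j)) + 1)"

text \<open>The third inequality closes the induction: at an open second last vertex the value
  \<open>string_rank opn j + 2\<close> must not exceed that of the string with one vertex fewer by
  more than one. The second, applied twice, bounds the resolution of that shorter string in the open
  case.\<close>

lemma string_rank_growth:
  "string_rank opn j \<le> string_rank opn (Suc j) \<and> string_rank opn (Suc j) \<le> string_rank opn j + 1 \<and>
   string_rank opn j + 1 \<le> string_rank opn (Suc (Suc j))"
proof (induction j rule: less_induct)
  case (less j)
  consider "j = 0" | "j = 1" | i where "j = Suc (Suc i)"
    by (metis One_nat_def not0_implies_Suc)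
  then show ?case
  proof cases
    case 3
    then show ?thesis using less[of i] less[of "Suc i"] by auto
  qed (use less[of 0] in auto)
qed

text \<open>Only the overlap pattern of the variable sets is recorded, so the property passes to
  prefixes and to colons. \<open>opn\<close> is a parameter and is not computed from
  \<open>ms\<close>: removing variables must leave \<open>string_rank opn\<close> unchanged. For
  length 1 the last clause alone keeps the generator from being constant.\<close>

definition gen_string :: "(nat \<Rightarrow> bool) \<Rightarrow> (nat \<Rightarrow> 'v set) \<Rightarrow> nat \<Rightarrow> bool" where
  "gen_string opn ms j \<longleftrightarrow>
    (\<forall>i k. 1 \<le> i \<longrightarrow> i + 2 \<le> k \<longrightarrow> k \<le> j \<longrightarrow> ms i \<inter> ms k = {}) \<and>
    (\<forall>i. 1 \<le> i \<longrightarrow> i < j \<longrightarrow> ms i \<inter> ms (Suc i) \<noteq> {} \<and> \<not> ms i \<subseteq> ms (Suc i) \<and> \<not> ms (Suc i) \<subseteq> ms i) \<and>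
    (\<forall>i. 1 < i \<longrightarrow> i < j \<longrightarrow> (opn i \<longleftrightarrow> ms i \<subseteq> ms (i - 1) \<union> ms (Suc i))) \<and>
    (\<forall>i. 1 \<le> i \<longrightarrow> i \<le> j \<longrightarrow> ms i \<noteq> {})"

lemma gen_string_disjoint:
  "gen_string opn ms j \<Longrightarrow> 1 \<le> i \<Longrightarrow> i + 2 \<le> k \<Longrightarrow> k \<le> j \<Longrightarrow> ms i \<inter> ms k = {}"
  and gen_string_inter: "gen_string opn ms j \<Longrightarrow> 1 \<le> i \<Longrightarrow> i < j \<Longrightarrow> ms i \<inter> ms (Suc i) \<noteq> {}"
  and gen_string_not_subset: "gen_string opn ms j \<Longrightarrow> 1 \<le> i \<Longrightarrow> i < j \<Longrightarrow> \<not> ms i \<subseteq> ms (Suc i)"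
  and gen_string_not_subset': "gen_string opn ms j \<Longrightarrow> 1 \<le> i \<Longrightarrow> i < j \<Longrightarrow> \<not> ms (Suc i) \<subseteq> ms i"
  and gen_string_open: "gen_string opn ms j \<Longrightarrow> 1 < i \<Longrightarrow> i < j \<Longrightarrow> opn i \<longleftrightarrow> ms i \<subseteq> ms (i - 1) \<union> ms (Suc i)"
  and gen_string_nonempty: "gen_string opn ms j \<Longrightarrow> 1 \<le> i \<Longrightarrow> i \<le> j \<Longrightarrow> ms i \<noteq> {}"
  by (simp_all add: gen_string_def)

lemma gen_string_prefix: "gen_string opn ms j \<Longrightarrow> i \<le> j \<Longrightarrow> gen_string opn ms i"
  by (auto simp: gen_string_def)

text \<open>This describes the colon ideal by the last generator: its neighbour, being closed, keeps a
  private variable.\<close>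

lemma gen_string_shrink:
  assumes s: "gen_string opn ms (Suc (Suc j))" and c: "j = 0 \<or> \<not> opn (Suc j)"
  shows "gen_string opn (ms(Suc j := ms (Suc j) - ms (Suc (Suc j)))) (Suc j)"
    (is "gen_string opn ?ms (Suc j)")
proof -
  have d: "ms i \<inter> ms (Suc (Suc j)) = {}" if "1 \<le> i" "i \<le> j" for i
    using that by (intro gen_string_disjoint[OF s]) auto
  have ne: "\<not> ms (Suc j) \<subseteq> ms (Suc (Suc j))" by (intro gen_string_not_subset[OF s]) auto
  \<comment> \<open>A closed inner vertex has a variable outside both neighbours. It survives the
    removal and keeps the last two sets of the shorter string incomparable.\<close>
  have cl: "\<not> ms (Suc j) \<subseteq> ms j \<union> ms (Suc (Suc j))" if "1 \<le> j"
    using c gen_string_open[OF s, of "Suc j"] that by auto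
  show ?thesis
    unfolding gen_string_def
  proof (intro conjI allI impI)
    fix i k assume "1 \<le> i" "i + 2 \<le> k" "k \<le> Suc j"
    then show "?ms i \<inter> ?ms k = {}"
      using gen_string_disjoint[OF s, of i k] by auto
  next
    fix i assume i: "1 \<le> i" "i < Suc j"
    then have "ms i \<inter> ms (Suc i) \<noteq> {}" "\<not> ms i \<subseteq> ms (Suc i)" "\<not> ms (Suc i) \<subseteq> ms i"
      using gen_string_inter[OF s, of i] gen_string_not_subset[OF s, of i]
        gen_string_not_subset'[OF s, of i] by simp_all
    then show "?ms i \<inter> ?ms (Suc i) \<noteq> {}" "\<not> ?ms i \<subseteq> ?ms (Suc i)" "\<not> ?ms (Suc i) \<subseteq> ?ms i"
      using i d[of i] cl by (cases "i = j"; auto)+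
  next
    fix i assume i: "1 < i" "i < Suc j"
    have "opn i \<longleftrightarrow> ms i \<subseteq> ms (i - 1) \<union> ms (Suc i)"
      using gen_string_open[OF s, of i] i by simp
    then show "opn i \<longleftrightarrow> ?ms i \<subseteq> ?ms (i - 1) \<union> ?ms (Suc i)"
      using i d[of i] by (cases "i = j") auto
  next
    fix i assume i: "1 \<le> i" "i \<le> Suc j"
    then show "?ms i \<noteq> {}" using gen_string_nonempty[OF s, of i] ne by auto
  qed
qed

text \<open>The variables in \<open>C\<close> generate a minimal prime of \<open>mono_ideal \<S>\<close>.\<close>

definition min_cover :: "'v set \<Rightarrow> 'v set set \<Rightarrow> bool" where
  "min_cover C \<S> \<longleftrightarrow> finite C \<and> (\<forall>S\<in>\<S>. S \<inter> C \<noteq> {}) \<and> (\<forall>v\<in>C. \<exists>S\<in>\<S>. S \<inter> C = {v})"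

lemma atLeastAtMost_1_Suc: "{1..Suc j} = insert (Suc j) {1..j}"
  by auto

text \<open>Each new element of the cover needs a generator that it alone hits. In the closed case
  one private variable of the last generator is added. In the open case a variable shared by the
  third last and the second last generator, together with a variable of the last one, serves three
  generators.\<close>

lemma min_cover_string_exists:
  assumes "gen_string opn ms j"
  shows "\<exists>C. min_cover C (ms ` {1..j}) \<and> card C = string_rank opn j"
  using assms
proof (induction j arbitrary: ms rule: less_induct)
  case (less j)
  have closed_step: "\<exists>C. min_cover C (ms ` {1..Suc (Suc i)}) \<and> card C = string_rank opn (Suc i) + 1"
    if j: "j = Suc (Suc i)" and c: "i = 0 \<or> \<not> opn (Suc i)" for i
  proof -
    have s: "gen_string opn ms (Suc (Suc i))" using less.prems j by simp
    let ?ms = "ms(Suc i := ms (Suc i) - ms (Suc (Suc i)))"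
    \<comment> \<open>The cover is taken for the colon and not for the prefix: it then avoids the
      last generator, which can witness the minimality of the element to be added.\<close>
    obtain C where C: "min_cover C (?ms ` {1..Suc i})" "card C = string_rank opn (Suc i)"
      using less.IH[OF _ gen_string_shrink[OF s c]] j by blast
    obtain v where v: "v \<in> ms (Suc (Suc i))" "v \<notin> ms (Suc i)"
      using gen_string_not_subset'[OF s, of "Suc i"] by auto
    have d: "ms k \<inter> ms (Suc (Suc i)) = {}" if "1 \<le> k" "k \<le> i" for k
      using that by (intro gen_string_disjoint[OF s]) auto
    have "C \<subseteq> \<Union> (?ms ` {1..Suc i})" using C(1) unfolding min_cover_def by blast
    moreover have dis: "?ms k \<inter> ms (Suc (Suc i)) = {}" if "k \<in> {1..Suc i}" for k
      using that d[of k] by (cases "k = Suc i") auto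
    ultimately have Cm: "C \<inter> ms (Suc (Suc i)) = {}" by blast
    have ms_C: "ms k \<inter> insert v C = ?ms k \<inter> C" if "k \<in> {1..Suc i}" for k
      using that Cm v d[of k] by (cases "k = Suc i") auto
    have last: "ms (Suc (Suc i)) \<inter> insert v C = {v}" using v Cm by auto
    have "min_cover (insert v C) (ms ` {1..Suc (Suc i)})"
      unfolding min_cover_def
    proof (intro conjI ballI)
      show "finite (insert v C)" using C by (simp add: min_cover_def)
    next
      fix S assume "S \<in> ms ` {1..Suc (Suc i)}"
      then obtain k where k: "k \<in> {1..Suc (Suc i)}" "S = ms k" by auto
      show "S \<inter> insert v C \<noteq> {}"
      proof (cases "k = Suc (Suc i)")
        case False
        then have "k \<in> {1..Suc i}" using k by auto
        moreover from this have "?ms k \<inter> C \<noteq> {}" using C unfolding min_cover_def by blast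
        ultimately show ?thesis unfolding k(2) using ms_C by blast
      qed (use last k in auto)
    next
      fix w assume "w \<in> insert v C"
      then consider "w = v" | "w \<in> C" by auto
      then show "\<exists>S\<in>ms ` {1..Suc (Suc i)}. S \<inter> insert v C = {w}"
      proof cases
        case 1
        then show ?thesis using last by (auto simp: atLeastAtMost_1_Suc[of "Suc i"])
      next
        case 2
        then have "\<exists>k\<in>{1..Suc i}. ?ms k \<inter> C = {w}" using C unfolding min_cover_def by blast
        then obtain k where k: "k \<in> {1..Suc i}" "?ms k \<inter> C = {w}" ..
        then have "ms k \<inter> insert v C = {w}" using ms_C by simp
        moreover have "ms k \<in> ms ` {1..Suc (Suc i)}" using k by auto
        ultimately show ?thesis by blast
      qed
    qed
    moreover have "card (insert v C) = card C + 1"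
      using C v Cm unfolding min_cover_def by (subst card_insert_disjoint) auto
    ultimately show ?thesis using C by (intro exI[of _ "insert v C"]) simp
  qed
  consider "j = 0" | "j = 1" | "j = 2" | i where "j = Suc (Suc (Suc i))" "\<not> opn (Suc (Suc i))"
    | i where "j = Suc (Suc (Suc i))" "opn (Suc (Suc i))"
  proof -
    have "j = 0 \<or> j = 1 \<or> j = 2 \<or> j = Suc (Suc (Suc (j - 3)))" by linarith
    then show ?thesis using that by blast
  qed
  then show ?case
  proof cases
    case 1
    then show ?thesis by (intro exI[of _ "{}"]) (simp add: min_cover_def)
  next
    case 2
    then obtain v where "v \<in> ms 1" using gen_string_nonempty[OF less.prems, of 1] by auto
    then show ?thesis using 2 by (intro exI[of _ "{v}"]) (auto simp: min_cover_def)
  next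
    case 3
    then show ?thesis using closed_step[of 0] by (simp add: numeral_2_eq_2)
  next
    case (4 i)
    then show ?thesis using closed_step[of "Suc i"] by simp
  next
    case (5 i)
    let ?j = "Suc (Suc (Suc i))"
    have s: "gen_string opn ms ?j" using less.prems 5 by simp
    obtain C where C: "min_cover C (ms ` {1..i})" "card C = string_rank opn i"
      using less.IH[of i ms] gen_string_prefix[OF s, of i] 5 by auto
    \<comment> \<open>\<open>e\<close> covers two generators at once and is witnessed by the second
      of them, \<open>v\<close> by the last one. The generator \<open>ms (Suc i)\<close> may also
      meet the old cover and serves as a witness for neither.\<close>
    obtain e where e: "e \<in> ms (Suc i)" "e \<in> ms (Suc (Suc i))"
      using gen_string_inter[OF s, of "Suc i"] by auto
    obtain v where v: "v \<in> ms ?j" "v \<notin> ms (Suc (Suc i))"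
      using gen_string_not_subset'[OF s, of "Suc (Suc i)"] by auto
    have dis: "ms k \<inter> ms l = {}" if "1 \<le> k" "k + 2 \<le> l" "l \<le> ?j" for k l
      using that by (intro gen_string_disjoint[OF s]) auto
    have CU: "C \<subseteq> \<Union> (ms ` {1..i})" using C(1) unfolding min_cover_def by blast
    have C_dis: "C \<inter> ms l = {}" if "l = Suc (Suc i) \<or> l = ?j" for l
    proof -
      have "ms k \<inter> ms l = {}" if "k \<in> {1..i}" for k
        using that \<open>l = Suc (Suc i) \<or> l = ?j\<close> by (intro dis) auto
      then show ?thesis using CU by blast
    qed
    have ev: "e \<notin> ms ?j" "v \<notin> ms (Suc i)" "e \<noteq> v"
      using dis[of "Suc i" ?j] e v by auto
    let ?C = "insert e (insert v C)"
    have old: "ms k \<inter> ?C = ms k \<inter> C" if "k \<in> {1..i}" for k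
      using that dis[of k "Suc (Suc i)"] dis[of k ?j] e v by auto
    have m2: "ms (Suc (Suc i)) \<inter> ?C = {e}" using C_dis[of "Suc (Suc i)"] e v by auto
    have m3: "ms ?j \<inter> ?C = {v}" using C_dis[of ?j] e v ev by auto
    have range: "k \<in> {1..i} \<or> k = Suc i \<or> k = Suc (Suc i) \<or> k = ?j" if "k \<in> {1..?j}" for k
      using that by auto
    have "min_cover ?C (ms ` {1..?j})"
      unfolding min_cover_def
    proof (intro conjI ballI)
      show "finite ?C" using C by (simp add: min_cover_def)
    next
      fix S assume "S \<in> ms ` {1..?j}"
      then obtain k where k: "k \<in> {1..?j}" "S = ms k" by auto
      then consider "k \<in> {1..i}" | "k = Suc i" | "k = Suc (Suc i)" | "k = ?j" using range by blast
      then show "S \<inter> ?C \<noteq> {}"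
      proof cases
        case 1
        then have "ms k \<inter> C \<noteq> {}" using C unfolding min_cover_def by blast
        then show ?thesis using old[OF 1] k by simp
      next
        case 2
        then show ?thesis using e k by blast
      qed (use k m2 m3 in auto)
    next
      fix w assume "w \<in> ?C"
      then consider "w = e" | "w = v" | "w \<in> C" by auto
      then show "\<exists>S\<in>ms ` {1..?j}. S \<inter> ?C = {w}"
      proof cases
        case 1
        then show ?thesis using m2 by (intro bexI[of _ "ms (Suc (Suc i))"]) auto
      next
        case 2
        then show ?thesis using m3 by (intro bexI[of _ "ms ?j"]) auto
      next
        case 3
        then have "\<exists>k\<in>{1..i}. ms k \<inter> C = {w}" using C unfolding min_cover_def by blast
        then obtain k where k: "k \<in> {1..i}" "ms k \<inter> C = {w}" ..
        then show ?thesis using old[of k] by (intro bexI[of _ "ms k"]) auto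
      qed
    qed
    moreover have "card ?C = card C + 2"
    proof -
      have "finite C" "v \<notin> C" "e \<notin> insert v C"
        using C v ev e C_dis[of ?j] C_dis[of "Suc (Suc i)"] by (auto simp: min_cover_def)
      then show ?thesis by simp
    qed
    ultimately show ?thesis using C 5 by (intro exI[of _ ?C]) simp
  qed
qed

lemma mono_ideal_eqI:
  assumes "\<And>S. S \<in> \<S> \<Longrightarrow> \<exists>T\<in>\<T>. T \<subseteq> S" "\<And>T. T \<in> \<T> \<Longrightarrow> \<exists>S\<in>\<S>. S \<subseteq> T"
  shows "mono_ideal \<S> = mono_ideal \<T>"
  using assms by (intro equalityI mono_ideal_antimono)

text \<open>The last generator is added to the ideal of the others. In the closed case both that
  ideal and the colon are strings with one vertex fewer, hence one more step suffices. In the open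
  case the colon has rank only \<open>string_rank opn i + 1\<close>, where \<open>i\<close> counts
  the vertices before the last three.\<close>

lemma resolvable_string:
  fixes ms :: "nat \<Rightarrow> 'v::finite set"
  assumes "gen_string opn ms j"
  shows "resolvable (string_rank opn j) (ideal_vec (mono_ideal (ms ` {1..j}) :: ('v, 'k::comm_ring_1) mpoly set))"
  using assms
proof (induction j arbitrary: ms rule: less_induct)
  case (less j)
  let ?I = "\<lambda>\<S>. ideal_vec (mono_ideal \<S> :: ('v, 'k) mpoly set)"
  have img: "ms ` {1..Suc k} = insert (ms (Suc k)) (ms ` {1..k})" for k
    unfolding atLeastAtMost_1_Suc by simp
  have dis: "ms i - ms (Suc (Suc k)) = ms i" if "i \<in> {1..k}" "Suc (Suc k) \<le> j" for i k
    using gen_string_disjoint[OF less.prems, of i "Suc (Suc k)"] that by auto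
  have colon: "(\<lambda>S. S - ms (Suc (Suc k))) ` ms ` {1..Suc k}
      = insert (ms (Suc k) - ms (Suc (Suc k))) (ms ` {1..k})" if "Suc (Suc k) \<le> j" for k
    unfolding img image_insert image_image using dis[OF _ that] by simp
  have closed_step: "resolvable (string_rank opn (Suc i) + 1) (?I (ms ` {1..Suc (Suc i)}))"
    if j: "j = Suc (Suc i)" and c: "i = 0 \<or> \<not> opn (Suc i)" for i
  proof -
    have s: "gen_string opn ms (Suc (Suc i))" using less.prems j by simp
    let ?ms = "ms(Suc i := ms (Suc i) - ms (Suc (Suc i)))"
    have "resolvable (string_rank opn (Suc i)) (?I (?ms ` {1..Suc i}))"
      by (rule less.IH[OF _ gen_string_shrink[OF s c]]) (simp add: j)
    moreover have "?ms ` {1..Suc i} = insert (ms (Suc i) - ms (Suc (Suc i))) (ms ` {1..i})"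
    proof -
      have "?ms ` {1..i} = ms ` {1..i}" by (rule image_cong) simp_all
      then show ?thesis unfolding atLeastAtMost_1_Suc image_insert by (simp only: fun_upd_same)
    qed
    moreover have "resolvable (string_rank opn (Suc i)) (?I (ms ` {1..Suc i}))"
      by (rule less.IH[OF _ gen_string_prefix[OF s]]) (simp_all add: j)
    ultimately show ?thesis
      unfolding img[of "Suc i"] Suc_eq_plus1[symmetric]
      using colon[of i] j by (intro resolvable_mono_ideal_insert resolvable_Suc) (simp_all only: order_refl)
  qed
  consider "j = 0" | "j = 1" | "j = 2" | i where "j = Suc (Suc (Suc i))" "\<not> opn (Suc (Suc i))"
    | i where "j = Suc (Suc (Suc i))" "opn (Suc (Suc i))"
  proof -
    have "j = 0 \<or> j = 1 \<or> j = 2 \<or> j = Suc (Suc (Suc (j - 3)))" by linarith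
    then show ?thesis using that by blast
  qed
  then show ?case
  proof cases
    case 1
    then show ?thesis by (simp add: ideal_vec_zero)
  next
    case 2
    have "resolvable 0 (?I {})" by (simp add: ideal_vec_zero)
    then have "resolvable (Suc 0) (?I {ms 1})"
      by (intro resolvable_mono_ideal_insert resolvable_Suc) (simp_all only: image_empty)
    then show ?thesis using 2 by (simp del: resolvable.simps)
  next
    case 3
    then show ?thesis using closed_step[of 0] by (simp add: numeral_2_eq_2 del: resolvable.simps)
  next
    case (4 i)
    then show ?thesis using closed_step[of "Suc i"] by (simp del: resolvable.simps)
  next
    case (5 i)
    let ?j = "Suc (Suc (Suc i))"
    have s: "gen_string opn ms ?j" using less.prems 5 by simp
    \<comment> \<open>What remains of the second last generator in the colon by the last one.
      Openness puts it inside \<open>ms (Suc i)\<close>, and it meets none of the earlier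
      generators.\<close>
    define E where "E = ms (Suc (Suc i)) - ms ?j"
    have opn: "ms (Suc (Suc i)) \<subseteq> ms (Suc i) \<union> ms ?j"
      using gen_string_open[OF s, of "Suc (Suc i)"] 5 by simp
    then have E: "E \<subseteq> ms (Suc i)" "E \<subseteq> ms (Suc (Suc i))" by (auto simp: E_def)
    have "ms k \<inter> ms (Suc (Suc i)) = {}" if "k \<in> {1..i}" for k
      using that by (intro gen_string_disjoint[OF s]) auto
    then have "(\<lambda>S. S - E) ` ms ` {1..i} = ms ` {1..i}"
      unfolding image_image using E by (intro image_cong) auto
    moreover have rec: "resolvable (string_rank opn i) (?I (ms ` {1..i}))"
      by (rule less.IH[OF _ gen_string_prefix[OF s]]) (simp_all add: 5)
    ultimately have "resolvable (Suc (string_rank opn i)) (?I (insert E (ms ` {1..i})))"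
      by (intro resolvable_mono_ideal_insert resolvable_Suc) (simp_all only:)
    \<comment> \<open>The generator \<open>ms (Suc i)\<close> is untouched by the colon, but it is a
      multiple of that of \<open>E\<close> and drops out.\<close>
    moreover have "?I (insert E (ms ` {1..i})) = ?I ((\<lambda>S. S - ms ?j) ` ms ` {1..Suc (Suc i)})"
    proof -
      have "mono_ideal (insert E (ms ` {1..i})) =
          (mono_ideal (insert E (insert (ms (Suc i)) (ms ` {1..i}))) :: ('v, 'k) mpoly set)"
        using E by (intro mono_ideal_eqI) auto
      then show ?thesis using colon[of "Suc i"] 5 unfolding img[of i] E_def by simp
    qed
    ultimately have "resolvable (Suc (string_rank opn i)) (?I ((\<lambda>S. S - ms ?j) ` ms ` {1..Suc (Suc i)}))"
      by simp
    \<comment> \<open>The ideal of the remaining generators keeps its own rank, possibly as large as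
      \<open>string_rank opn i + 2\<close>; this is exactly what one step above the colon
      admits.\<close>
    moreover have "resolvable (string_rank opn i + 2) (?I (ms ` {1..Suc (Suc i)}))"
    proof (rule resolvable_mono)
      show "resolvable (string_rank opn (Suc (Suc i))) (?I (ms ` {1..Suc (Suc i)}))"
        by (rule less.IH[OF _ gen_string_prefix[OF s]]) (simp_all add: 5)
      show "string_rank opn (Suc (Suc i)) \<le> string_rank opn i + 2"
        using string_rank_growth[of opn i] string_rank_growth[of opn "Suc i"] by simp
    qed
    ultimately have "resolvable (Suc (Suc (string_rank opn i))) (?I (insert (ms ?j) (ms ` {1..Suc (Suc i)})))"
      by (intro resolvable_mono_ideal_insert) (simp_all only: add_2_eq_Suc')
    then show ?thesis unfolding 5(1) img[of "Suc (Suc i)"] using 5(2) by (simp del: resolvable.simps)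
  qed
qed

subsection \<open>Binomial generators up to radical\<close>

lemma sqf_monomial_dvd:
  fixes S T U :: "'v::finite set"
  assumes "S \<subseteq> T \<union> U"
  shows "\<exists>r. (sqf_monomial T * sqf_monomial U :: ('v, 'k::comm_ring_1) mpoly) = r * sqf_monomial S"
  unfolding sqf_monomial_eq_single[of T] sqf_monomial_eq_single[of U] mult_single
  using single_factor_sqf_monomial[of S "expo T + expo U"] assms by (auto simp: keys_add_nat)

lemma mono_or_binomial_sqf_monomial: "mono_or_binomial (sqf_monomial (S :: 'v::finite set))"
  by (simp add: mono_or_binomial_def sqf_monomial_eq_single)

lemma mono_or_binomial_add_sqf_monomial:
  "mono_or_binomial (sqf_monomial (S :: 'v::finite set) + sqf_monomial T)"
proof -
  have "keys (sqf_monomial S + sqf_monomial T :: ('v, 'a) mpoly) \<subseteq> {expo S, expo T}"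
    using keys_add[of "sqf_monomial S :: ('v, 'a) mpoly" "sqf_monomial T"]
    by (auto simp: sqf_monomial_eq_single)
  then have "card (keys (sqf_monomial S + sqf_monomial T :: ('v, 'a) mpoly)) \<le> card {expo S, expo T}"
    by (intro card_mono) auto
  also have "\<dots> \<le> 2" by (simp add: card_insert_if)
  finally show ?thesis by (simp add: mono_or_binomial_def)
qed

lemma binomials_string_exist:
  fixes ms :: "nat \<Rightarrow> 'v::finite set"
  assumes "gen_string opn ms j"
  shows "\<exists>Q :: ('v, 'k::comm_ring_1) mpoly set. finite Q \<and> card Q \<le> string_rank opn j \<and>
    (\<forall>q\<in>Q. mono_or_binomial q) \<and> Q \<subseteq> mono_ideal (ms ` {1..j}) \<and>
    sqf_monomial ` ms ` {1..j} \<subseteq> radical (ideal_gen Q)"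
  using assms
proof (induction j rule: less_induct)
  case (less j)
  let ?P = "\<lambda>j n (Q :: ('v, 'k) mpoly set). finite Q \<and> card Q \<le> n \<and>
    (\<forall>q\<in>Q. mono_or_binomial q) \<and> Q \<subseteq> mono_ideal (ms ` {1..j}) \<and>
    sqf_monomial ` ms ` {1..j} \<subseteq> radical (ideal_gen Q)"
  have mono: "mono_ideal (ms ` {1..i}) \<subseteq> (mono_ideal (ms ` {1..k}) :: ('v, 'k) mpoly set)" if "i \<le> k" for i k
    using that by (intro mono_ideal_antimono) auto
  have rad: "radical (ideal_gen Q) \<subseteq> radical (ideal_gen Q')" if "Q \<subseteq> Q'" for Q Q' :: "('v, 'k) mpoly set"
    using that by (intro radical_mono ideal_gen_mono)
  have gen: "x \<in> radical (ideal_gen Q)" if "x \<in> Q" for x and Q :: "('v, 'k) mpoly set"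
    using that ideal_gen_superset radical_superset by blast
  have mem: "sqf_monomial (ms i) \<in> (mono_ideal (ms ` {1..k}) :: ('v, 'k) mpoly set)" if "i \<in> {1..k}" for i k
    using that by (auto simp: sqf_monomial_in_mono_ideal)
  have step: "\<exists>Q. ?P (Suc i) (n + 1) Q" if "\<exists>Q. ?P i n Q" for i n
  proof -
    obtain Q where Q: "?P i n Q" using \<open>\<exists>Q. ?P i n Q\<close> ..
    let ?m = "sqf_monomial (ms (Suc i)) :: ('v, 'k) mpoly"
    let ?Q = "insert ?m Q"
    have "card ?Q \<le> n + 1" using Q by (intro card_insert_le_m1) auto
    moreover have "?Q \<subseteq> mono_ideal (ms ` {1..Suc i})" using Q mono[of i "Suc i"] mem[of "Suc i" "Suc i"] by auto
    moreover have "sqf_monomial ` ms ` {1..Suc i} \<subseteq> radical (ideal_gen ?Q)"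
      unfolding atLeastAtMost_1_Suc image_insert
      using Q rad[OF subset_insertI[of Q ?m]] gen[of ?m ?Q] by (meson insertI1 insert_subset order_trans)
    ultimately show ?thesis using Q by (intro exI[of _ ?Q]) (auto simp: mono_or_binomial_sqf_monomial)
  qed
  \<comment> \<open>Wherever the rank grows by one, the last generator itself is added. This covers
    lengths 1 and 2 as well as a closed second last vertex.\<close>
  consider "j = 0" | i where "j = Suc i" "string_rank opn j = string_rank opn i + 1"
    | i where "j = Suc (Suc (Suc i))" "opn (Suc (Suc i))"
  proof -
    have "j = 0 \<or> j = Suc 0 \<or> j = Suc (Suc 0) \<or> j = Suc (Suc (Suc (j - 3)))" by linarith
    then show ?thesis using that by (elim disjE) (simp, simp, simp, metis add_2_eq_Suc' string_rank.simps(4))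
  qed
  then show ?case
  proof cases
    case 1
    then show ?thesis by (intro exI[of _ "{}"]) simp
  next
    case (2 i)
    then show ?thesis
      using step[of "string_rank opn i" i] less.IH[of i] gen_string_prefix[OF less.prems, of i] by simp
  next
    case (3 i)
    let ?j = "Suc (Suc (Suc i))"
    have s: "gen_string opn ms ?j" using less.prems 3 by simp
    have "\<exists>Q. ?P i (string_rank opn i) Q"
      by (rule less.IH[OF _ gen_string_prefix[OF s]]) (simp_all add: 3)
    then obtain Q where Q: "?P i (string_rank opn i) Q" ..
    let ?a = "sqf_monomial (ms (Suc i)) :: ('v, 'k) mpoly"
    let ?m = "sqf_monomial (ms (Suc (Suc i))) :: ('v, 'k) mpoly"
    let ?b = "sqf_monomial (ms ?j) :: ('v, 'k) mpoly"
    let ?Q = "insert ?m (insert (?a + ?b) Q)"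
    have I: "is_ideal (ideal_gen ?Q)" by (rule is_ideal_ideal_gen)
    have m: "?m \<in> ideal_gen ?Q" "?a + ?b \<in> ideal_gen ?Q" by (auto intro: ideal_gen_superset)
    have "ms (Suc (Suc i)) \<subseteq> ms (Suc i) \<union> ms ?j"
      using gen_string_open[OF s, of "Suc (Suc i)"] 3 by simp
    then obtain r where "?a * ?b = r * ?m" using sqf_monomial_dvd by blast
    then have ab: "?a * ?b \<in> ideal_gen ?Q" using I m by (simp add: is_ideal_mult)
    \<comment> \<open>Both neighbours are roots of X^2 - (a + b) X + ab, whose lower coefficients
      lie in the ideal, so they are nilpotent modulo it.\<close>
    have "?a ^ 2 = ?a * (?a + ?b) - ?a * ?b" "?b ^ 2 = ?b * (?a + ?b) - ?a * ?b"
      by (simp_all add: algebra_simps power2_eq_square)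
    then have "?a ^ 2 \<in> ideal_gen ?Q" "?b ^ 2 \<in> ideal_gen ?Q"
      using is_ideal_diff[OF I is_ideal_mult[OF I m(2)] ab] by simp_all
    then have rab: "?a \<in> radical (ideal_gen ?Q)" "?b \<in> radical (ideal_gen ?Q)"
      by (auto simp: radical_def)
    have "card ?Q \<le> string_rank opn i + 2"
    proof -
      have "card (insert (?a + ?b) Q) \<le> string_rank opn i + 1" using Q by (intro card_insert_le_m1) auto
      then show ?thesis using Q by (intro card_insert_le_m1) auto
    qed
    moreover have "?a \<in> mono_ideal (ms ` {1..?j})" "?b \<in> mono_ideal (ms ` {1..?j})"
      "?m \<in> mono_ideal (ms ` {1..?j})" by (rule mem; simp)+
    then have "?Q \<subseteq> mono_ideal (ms ` {1..?j})"
      using Q mono[of i ?j] is_ideal_add[OF is_ideal_mono_ideal, of ?a _ ?b] by auto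
    moreover have "sqf_monomial ` ms ` {1..?j} \<subseteq> radical (ideal_gen ?Q)"
    proof -
      have "sqf_monomial ` ms ` {1..i} \<subseteq> radical (ideal_gen ?Q)" using Q rad[of Q ?Q] by (meson order_trans subset_insertI)
      then show ?thesis
        unfolding atLeastAtMost_1_Suc image_insert using gen[of ?m ?Q] rab by simp
    qed
    ultimately have "?P ?j (string_rank opn i + 2) ?Q"
      using Q by (simp add: mono_or_binomial_sqf_monomial mono_or_binomial_add_sqf_monomial)
    then show ?thesis unfolding 3(1) using 3(2) by (intro exI[of _ ?Q]) simp
  qed
qed

subsection \<open>Lower bound for the length of free resolutions\<close>

definition vec_in :: "('v, 'k::comm_ring_1) mpoly set \<Rightarrow> (nat \<Rightarrow> ('v, 'k) mpoly) set" where
  "vec_in Q = {x. \<forall>k. x k \<in> Q}"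

lemma submodule_vec_in: "is_ideal Q \<Longrightarrow> submodule (vec_in Q)"
  by (auto simp: submodule_def vec_in_def is_ideal_zero is_ideal_add is_ideal_mult)

lemma submodule_free_mod: "submodule (free_mod n)"
  by (auto simp: submodule_def free_mod_def)

lemma matapp_diff: "matapp A m n (x - y) = matapp A m n x - matapp A m n y"
  by (rule ext) (simp add: matapp_def right_diff_distrib sum_subtractf)

lemma matapp_smult: "matapp A m n (\<lambda>k. a * x k) = (\<lambda>k. a * matapp A m n x k)"
  by (rule ext) (simp add: matapp_def sum_distrib_left mult.left_commute)

lemma matapp_zero: "matapp A m n 0 = 0"
  by (rule ext) (simp add: matapp_def)

lemma matapp_in_free_mod: "matapp A m n x \<in> free_mod m"
  by (simp add: matapp_def free_mod_def)

lemma matapp_in_vec_in: "is_ideal Q \<Longrightarrow> x \<in> vec_in Q \<Longrightarrow> matapp A m n x \<in> vec_in Q"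
  by (auto simp: matapp_def vec_in_def is_ideal_zero intro!: is_ideal_sum is_ideal_mult)

definition add_gen :: "('v, 'k::comm_ring_1) mpoly set \<Rightarrow> ('v, 'k) mpoly \<Rightarrow> ('v, 'k) mpoly set" where
  "add_gen Q x = {q + a * x | q a. q \<in> Q}"

text \<open>Regularity on R/Q in the weak sense: the last quotient may vanish. In the bound on the
  length of a resolution, nontriviality is carried by the element \<open>y\<close>.\<close>

primrec regular_seq :: "('v, 'k::comm_ring_1) mpoly set \<Rightarrow> ('v, 'k) mpoly list \<Rightarrow> bool" where
  "regular_seq Q [] = True"
| "regular_seq Q (x # xs) = ((\<forall>a. x * a \<in> Q \<longrightarrow> a \<in> Q) \<and> regular_seq (add_gen Q x) xs)"

lemma is_ideal_add_gen:
  assumes "is_ideal Q" shows "is_ideal (add_gen Q x)"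
  unfolding is_ideal_def
proof (intro conjI ballI allI)
  show "0 \<in> add_gen Q x" unfolding add_gen_def
    by (intro CollectI exI[of _ 0]) (simp add: is_ideal_zero assms)
next
  fix a b assume "a \<in> add_gen Q x" "b \<in> add_gen Q x"
  then obtain q r q' r' where *: "a = q + r * x" "q \<in> Q" "b = q' + r' * x" "q' \<in> Q"
    by (auto simp: add_gen_def)
  have "a + b = (q + q') + (r + r') * x" by (simp add: * algebra_simps)
  moreover have "q + q' \<in> Q" by (intro is_ideal_add assms *)
  ultimately show "a + b \<in> add_gen Q x" unfolding add_gen_def by (intro CollectI exI conjI)
next
  fix s a assume "a \<in> add_gen Q x"
  then obtain q r where *: "a = q + r * x" "q \<in> Q" by (auto simp: add_gen_def)
  have "s * a = s * q + (s * r) * x" by (simp add: * algebra_simps)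
  moreover have "s * q \<in> Q" by (intro is_ideal_mult assms *)
  ultimately show "s * a \<in> add_gen Q x" unfolding add_gen_def by (intro CollectI exI conjI)
qed

lemma vec_in_add_gen_decomp:
  assumes "z \<in> vec_in (add_gen Q x)" "z \<in> free_mod n" "is_ideal Q"
  shows "\<exists>a\<in>free_mod n. z - (\<lambda>k. x * a k) \<in> vec_in Q"
proof -
  have "\<exists>a. z k - x * a \<in> Q" for k
  proof -
    have "z k \<in> add_gen Q x" using assms(1) by (simp add: vec_in_def)
    then obtain q a where "z k = q + a * x" "q \<in> Q" by (auto simp: add_gen_def)
    then have "z k - x * a = q" by (simp add: mult.commute)
    then show ?thesis using \<open>q \<in> Q\<close> by auto
  qed
  then have "\<forall>k. \<exists>a. z k - x * a \<in> Q" by blast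
  from choice[OF this] obtain a where a: "\<And>k. z k - x * a k \<in> Q" by blast
  \<comment> \<open>Setting the quotients to zero from \<open>n\<close> on keeps them in the free
    module; there \<open>z\<close> vanishes as well.\<close>
  let ?a = "\<lambda>k. if k < n then a k else 0"
  have "z k - x * ?a k \<in> Q" for k
    using a[of k] assms(2,3) by (auto simp: free_mod_def is_ideal_zero)
  then show ?thesis by (intro bexI[of _ ?a]) (auto simp: vec_in_def free_mod_def)
qed

lemma vec_in_add_gen:
  assumes "z - (\<lambda>k. x * a k) \<in> vec_in Q" shows "z \<in> vec_in (add_gen Q x)"
  unfolding vec_in_def add_gen_def
proof (intro CollectI allI)
  fix k
  have "z k = (z k - x * a k) + a k * x" by (simp add: mult.commute)
  moreover have "z k - x * a k \<in> Q" using assms by (auto simp: vec_in_def)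
  ultimately show "\<exists>q a. z k = q + a * x \<and> q \<in> Q" by blast
qed

text \<open>Instead of passing to quotient rings, a complex is considered modulo an ideal \<open>Q\<close>. If
  \<open>y\<close> represents a nonzero element of the cokernel \<open>M\<close> that is killed by the sequence
  \<open>x # xs\<close>, then \<open>x * y\<close> is a nonzero element of \<open>Z/xZ\<close> killed by \<open>xs\<close>, where \<open>Z\<close> is the first
  syzygy module of \<open>M\<close>; and the tail of the complex modulo \<open>x\<close> resolves \<open>Z/xZ\<close>.\<close>

lemma resolution_length_ge_regular_seq:
  fixes d :: "nat \<Rightarrow> nat \<Rightarrow> nat \<Rightarrow> ('v, 'k::comm_ring_1) mpoly" and b :: "nat \<Rightarrow> nat"
  defines "D \<equiv> \<lambda>j. matapp (d j) (b (j - 1)) (b j)"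
  assumes b0: "\<And>j. p < j \<Longrightarrow> b j = 0"
    and dd: "\<And>j x. 1 \<le> j \<Longrightarrow> x \<in> free_mod (b (Suc j)) \<Longrightarrow> D j (D (Suc j) x) = 0"
  assumes "is_ideal Q" "regular_seq Q xs"
    and "\<And>j z. i < j \<Longrightarrow> z \<in> free_mod (b j) \<Longrightarrow> D j z \<in> vec_in Q \<Longrightarrow>
      \<exists>w\<in>free_mod (b (Suc j)). z - D (Suc j) w \<in> vec_in Q"
    and "y \<in> free_mod (b i)"
    and "\<And>w. w \<in> free_mod (b (Suc i)) \<Longrightarrow> y - D (Suc i) w \<notin> vec_in Q"
    and "\<And>x. x \<in> set xs \<Longrightarrow> \<exists>w\<in>free_mod (b (Suc i)). (\<lambda>k. x * y k) - D (Suc i) w \<in> vec_in Q"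
  shows "i + length xs \<le> p"
  using assms(4-)
proof (induction xs arbitrary: Q i y)
  case Nil
  have "i \<le> p"
  proof (rule ccontr)
    assume "\<not> i \<le> p"
    \<comment> \<open>Beyond \<open>p\<close> the modules are zero, so \<open>y\<close> would be the
      boundary of 0.\<close>
    then have "y = 0" using b0[of i] Nil.prems(4) by simp
    moreover have "0 \<in> free_mod (b (Suc i))" by (rule submodule_zero[OF submodule_free_mod])
    moreover have "D (Suc i) 0 = 0" unfolding D_def by (rule matapp_zero)
    ultimately show False
      using Nil.prems(5)[of 0] submodule_zero[OF submodule_vec_in[OF Nil.prems(1)]]
      by (simp only: diff_zero simp_thms)
  qed
  then show ?case by simp
next
  case (Cons x xs)
  note Q = Cons.prems(1) and exact = Cons.prems(3) and y = Cons.prems(4)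
    and ynot = Cons.prems(5) and kill = Cons.prems(6)
  let ?V = "vec_in Q" and ?Q' = "add_gen Q x"
  note V = submodule_vec_in[OF Q]
  have D_sub: "D j (u - v) = D j u - D j v" for j u v by (simp add: D_def matapp_diff)
  have D_sm: "D j (\<lambda>k. a * u k) = (\<lambda>k. a * D j u k)" for j a u by (simp add: D_def matapp_smult)
  have D_V: "u \<in> ?V \<Longrightarrow> D j u \<in> ?V" for j u by (simp add: D_def matapp_in_vec_in Q)
  have D_F: "D j u \<in> free_mod (b (j - 1))" for j u by (simp add: D_def matapp_in_free_mod)
  have nzd: "(\<lambda>k. x * u k) \<in> ?V \<Longrightarrow> u \<in> ?V" for u
    using Cons.prems(2) by (auto simp: vec_in_def)
  have F_sub: "u - (\<lambda>k. a * v k) \<in> free_mod n" if "u \<in> free_mod n" "v \<in> free_mod n" for a u v n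
    using that by (intro submodule_diff submodule_smult submodule_free_mod)
  \<comment> \<open>As \<open>x\<close> kills the class of \<open>y\<close>, the element
    \<open>x * y\<close> lies in the syzygy module Z modulo \<open>Q\<close>. Its preimage
    \<open>w\<close> represents it in Z/xZ and takes over the role of \<open>y\<close>.\<close>
  obtain w where w: "w \<in> free_mod (b (Suc i))" "(\<lambda>k. x * y k) - D (Suc i) w \<in> ?V"
    using kill[OF list.set_intros(1)] by (rule bexE)
  have "Suc i + length xs \<le> p"
  proof (rule Cons.IH[of ?Q' "Suc i" w])
    show "is_ideal ?Q'" by (rule is_ideal_add_gen[OF Q])
    show "regular_seq ?Q' xs" using Cons.prems(2) by simp
    show "w \<in> free_mod (b (Suc i))" by (rule w)
  next
    fix j z assume j: "Suc i < j" and z: "z \<in> free_mod (b j)" and Dz: "D j z \<in> vec_in ?Q'"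
    obtain a where a: "a \<in> free_mod (b (j - 1))" "D j z - (\<lambda>k. x * a k) \<in> ?V"
      using vec_in_add_gen_decomp[OF Dz D_F Q] by (rule bexE)
    \<comment> \<open>Exactness modulo \<open>x\<close>: from D z = x a follows x D a = 0, hence D a
      = 0 and a = D c. So z - x c is a cycle, and thus a boundary. The index \<open>j - 1\<close>
      still exceeds \<open>i\<close>, where exactness is available.\<close>
    have "D (j - 1) (D j z) = 0" using dd[of "j - 1" z] j z by simp
    then have "D (j - 1) (D j z - (\<lambda>k. x * a k)) = - (\<lambda>k. x * D (j - 1) a k)"
      by (simp add: D_sub D_sm)
    then have "- (\<lambda>k. x * D (j - 1) a k) \<in> ?V" using D_V[OF a(2), of "j - 1"] by simp
    then have "- (- (\<lambda>k. x * D (j - 1) a k)) \<in> ?V" by (rule submodule_uminus[OF V])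
    then have "(\<lambda>k. x * D (j - 1) a k) \<in> ?V" by simp
    then have "D (j - 1) a \<in> ?V" by (rule nzd)
    moreover have "Suc (j - 1) = j" "i < j - 1" using j by simp_all
    ultimately have "\<exists>c\<in>free_mod (b j). a - D j c \<in> ?V"
      using exact[of "j - 1" a] a(1) by metis
    then obtain c where c: "c \<in> free_mod (b j)" "a - D j c \<in> ?V" by (rule bexE)
    have "D j (z - (\<lambda>k. x * c k)) = (D j z - (\<lambda>k. x * a k)) + (\<lambda>k. x * (a - D j c) k)"
      by (simp add: D_sub D_sm fun_eq_iff algebra_simps)
    also have "\<dots> \<in> ?V" by (intro submodule_add submodule_smult V a c)
    finally have "D j (z - (\<lambda>k. x * c k)) \<in> ?V" .
    from exact[OF Suc_lessD[OF j] F_sub[OF z c(1)] this] obtain e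
      where e: "e \<in> free_mod (b (Suc j))" "z - (\<lambda>k. x * c k) - D (Suc j) e \<in> ?V" by (rule bexE)
    have "z - (\<lambda>k. x * c k) - D (Suc j) e = z - D (Suc j) e - (\<lambda>k. x * c k)"
      by (simp add: fun_eq_iff)
    with e(2) have "z - D (Suc j) e - (\<lambda>k. x * c k) \<in> ?V" by simp
    then have "z - D (Suc j) e \<in> vec_in ?Q'" by (rule vec_in_add_gen)
    then show "\<exists>e\<in>free_mod (b (Suc j)). z - D (Suc j) e \<in> vec_in ?Q'"
      by (intro bexI[of _ e] e)
  next
    fix u :: "nat \<Rightarrow> ('v, 'k) mpoly" assume u: "u \<in> free_mod (b (Suc (Suc i)))"
    show "w - D (Suc (Suc i)) u \<notin> vec_in ?Q'"
    proof
      assume *: "w - D (Suc (Suc i)) u \<in> vec_in ?Q'"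
      have "w - D (Suc (Suc i)) u \<in> free_mod (b (Suc i))"
        using D_F[of "Suc (Suc i)" u] w(1) by (intro submodule_diff submodule_free_mod) simp_all
      from vec_in_add_gen_decomp[OF * this Q] obtain a where a: "a \<in> free_mod (b (Suc i))"
        "w - D (Suc (Suc i)) u - (\<lambda>k. x * a k) \<in> ?V" by (rule bexE)
      \<comment> \<open>If \<open>w\<close> were D u + x a, then x y = D w = x D a, and cancelling
        \<open>x\<close> would make \<open>y\<close> a boundary.\<close>
      have "(\<lambda>k. x * (y - D (Suc i) a) k) = ((\<lambda>k. x * y k) - D (Suc i) w)
          + D (Suc i) (w - D (Suc (Suc i)) u - (\<lambda>k. x * a k))"
        unfolding D_sub D_sm using dd[of "Suc i" u] u by (simp add: fun_eq_iff algebra_simps)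
      also have "\<dots> \<in> ?V" by (intro submodule_add V w D_V a)
      finally have "y - D (Suc i) a \<in> ?V" by (rule nzd)
      then show False using ynot[OF a(1)] by contradiction
    qed
  next
    fix x' assume x': "x' \<in> set xs"
    then have "x' \<in> set (x # xs)" by simp
    from kill[OF this] obtain w'
      where w': "w' \<in> free_mod (b (Suc i))" "(\<lambda>k. x' * y k) - D (Suc i) w' \<in> ?V"
      by (rule bexE)
    \<comment> \<open>Both products have the boundary x x' y modulo \<open>Q\<close>, so the
      difference is a cycle; as a boundary it shows that \<open>x'\<close> kills the class of
      \<open>w\<close> modulo \<open>x\<close>.\<close>
    let ?z = "(\<lambda>k. x' * w k) - (\<lambda>k. x * w' k)"
    have "D (Suc i) ?z = (\<lambda>k. x * ((\<lambda>k. x' * y k) - D (Suc i) w') k)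
        - (\<lambda>k. x' * ((\<lambda>k. x * y k) - D (Suc i) w) k)"
      by (simp add: D_sub D_sm fun_eq_iff algebra_simps)
    also have "\<dots> \<in> ?V" by (intro submodule_diff submodule_smult V w w')
    finally have "D (Suc i) ?z \<in> ?V" .
    from exact[OF lessI F_sub[OF submodule_smult[OF submodule_free_mod w(1)] w'(1)] this]
    obtain u where u: "u \<in> free_mod (b (Suc (Suc i)))" "?z - D (Suc (Suc i)) u \<in> ?V" by (rule bexE)
    have "?z - D (Suc (Suc i)) u = (\<lambda>k. x' * w k) - D (Suc (Suc i)) u - (\<lambda>k. x * w' k)"
      by (simp add: fun_eq_iff)
    with u(2) have "(\<lambda>k. x' * w k) - D (Suc (Suc i)) u - (\<lambda>k. x * w' k) \<in> ?V" by simp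
    then have "(\<lambda>k. x' * w k) - D (Suc (Suc i)) u \<in> vec_in ?Q'" by (rule vec_in_add_gen)
    then show "\<exists>u\<in>free_mod (b (Suc (Suc i))). (\<lambda>k. x' * w k) - D (Suc (Suc i)) u \<in> vec_in ?Q'"
      by (intro bexI[of _ u] u)
  qed
  then show ?case by simp
qed

lemma Var_eq_sqf_monomial: "Var v = sqf_monomial {v}"
  by (simp add: sqf_monomial_def)

text \<open>Removing a variable outside \<open>A\<close> changes none of the singletons, so the
  colon of the ideal of these variables is the ideal itself.\<close>

lemma regular_seq_Vars:
  fixes A :: "'v::finite set"
  assumes "distinct vs" "set vs \<inter> A = {}"
  shows "regular_seq (mono_ideal ((\<lambda>v. {v}) ` A) :: ('v, 'k::comm_ring_1) mpoly set) (map Var vs)"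
  using assms
proof (induction vs arbitrary: A)
  case (Cons v vs)
  have "(\<lambda>S. S - {v}) ` (\<lambda>v. {v}) ` A = (\<lambda>v. {v}) ` A"
    unfolding image_image using Cons.prems by (intro image_cong) auto
  then have "a \<in> mono_ideal ((\<lambda>v. {v}) ` A)" if "Var v * a \<in> mono_ideal ((\<lambda>v. {v}) ` A)"
    for a :: "('v, 'k) mpoly"
    using that mono_ideal_mult_sqf_monomial[of a "{v}" "(\<lambda>v. {v}) ` A"]
    by (simp add: Var_eq_sqf_monomial mult.commute)
  moreover have "add_gen (mono_ideal ((\<lambda>v. {v}) ` A)) (Var v)
      = (mono_ideal ((\<lambda>v. {v}) ` insert v A) :: ('v, 'k) mpoly set)"
    by (simp add: add_gen_def Var_eq_sqf_monomial mono_ideal_insert)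
  moreover have "regular_seq (mono_ideal ((\<lambda>v. {v}) ` insert v A) :: ('v, 'k) mpoly set) (map Var vs)"
    using Cons.prems by (intro Cons.IH) auto
  ultimately show ?case by simp
qed simp

text \<open>No generator avoids \<open>C\<close>, which keeps the product outside the ideal. A
  generator that meets \<open>C\<close> only in \<open>v\<close> divides \<open>v\<close> times the
  product.\<close>

lemma min_cover_sqf_monomial_compl:
  fixes \<S> :: "'v::finite set set"
  assumes "min_cover C \<S>"
  shows "sqf_monomial (- C) \<notin> (mono_ideal \<S> :: ('v, 'k::comm_ring_1) mpoly set)"
    and "v \<in> C \<Longrightarrow> Var v * sqf_monomial (- C) \<in> (mono_ideal \<S> :: ('v, 'k) mpoly set)"
proof -
  have "\<not> S \<subseteq> - C" if "S \<in> \<S>" for S using assms that unfolding min_cover_def by blast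
  then show "sqf_monomial (- C) \<notin> (mono_ideal \<S> :: ('v, 'k) mpoly set)"
    by (auto simp: sqf_monomial_in_mono_ideal)
next
  assume "v \<in> C"
  then obtain S where S: "S \<in> \<S>" "S \<inter> C = {v}" using assms unfolding min_cover_def by blast
  then have "S \<subseteq> {v} \<union> - C" by auto
  then obtain r where "(Var v * sqf_monomial (- C) :: ('v, 'k) mpoly) = r * sqf_monomial S"
    unfolding Var_eq_sqf_monomial using sqf_monomial_dvd by blast
  moreover have "sqf_monomial S \<in> (mono_ideal \<S> :: ('v, 'k) mpoly set)"
    using S by (auto simp: sqf_monomial_in_mono_ideal)
  ultimately show "Var v * sqf_monomial (- C) \<in> (mono_ideal \<S> :: ('v, 'k) mpoly set)"
    by (simp add: mono_ideal_mult)
qed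

lemma free_resolution_length_ge_min_cover:
  fixes \<S> :: "'v::finite set set"
  assumes res: "is_free_resolution (mono_ideal \<S> :: ('v, 'k::comm_ring_1) mpoly set) p b d e"
    and C: "min_cover C \<S>"
  shows "card C \<le> p"
proof -
  let ?I = "mono_ideal \<S> :: ('v, 'k) mpoly set"
  let ?f = "sqf_monomial (- C) :: ('v, 'k) mpoly"
  define eps where "eps x = (\<Sum>k<b 0. x k * e k)" for x
  note res' = res[unfolded is_free_resolution_def, folded eps_def]
  note I = is_ideal_mono_ideal[of \<S>, where ?'b = 'k]
  \<comment> \<open>The ranks are constrained only up to \<open>p\<close>. Zeros beyond it turn
    injectivity of the last map into exactness at \<open>p\<close>, so the complex is exact in every
    positive degree.\<close>
  define b' where "b' j = (if j \<le> p then b j else 0)" for j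
  define D where "D j = matapp (d j) (b' (j - 1)) (b' j)" for j
  have b'0: "b' 0 = b 0" by (simp add: b'_def)
  have F0: "0 \<in> free_mod n" for n by (rule submodule_zero[OF submodule_free_mod])
  have V0: "vec_in {0} = {0 :: nat \<Rightarrow> ('v, 'k) mpoly}" by (auto simp: vec_in_def fun_eq_iff)
  have D0: "D j 0 = 0" for j by (simp add: D_def matapp_zero)
  have exact: "{x \<in> free_mod (b' j). D j x = 0} = D (Suc j) ` free_mod (b' (Suc j))" if "1 \<le> j" for j
  proof -
    consider "j < p" | "j = p" | "p < j" by linarith
    then show ?thesis
    proof cases
      case 1
      then have "{x \<in> free_mod (b j). matapp (d j) (b (j - 1)) (b j) x = (\<lambda>_. 0)}
          = matapp (d (j + 1)) (b j) (b (j + 1)) ` free_mod (b (j + 1))"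
        using res' that by simp
      moreover have "b' j = b j" "b' (j - 1) = b (j - 1)" "b' (Suc j) = b (Suc j)"
        using 1 by (auto simp: b'_def)
      ultimately show ?thesis by (simp add: D_def zero_fun_def)
    next
      case 2
      have "x = 0" if "x \<in> free_mod (b' j)" "D j x = 0" for x
        using res' that \<open>1 \<le> j\<close> 2 by (simp add: D_def b'_def zero_fun_def)
      then have "{x \<in> free_mod (b' j). D j x = 0} = {0}" using F0 D0 by auto
      with 2 D0 show ?thesis by (simp add: b'_def)
    next
      case 3
      then show ?thesis using D0 by (auto simp: b'_def)
    qed
  qed
  have exact0: "{x \<in> free_mod (b' 0). eps x \<in> ?I} = D 1 ` free_mod (b' 1)"
  proof (cases "p = 0")
    case True
    then have "x = 0" if "x \<in> free_mod (b 0)" "eps x \<in> ?I" for x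
      using res' that by (simp add: zero_fun_def)
    moreover have "eps 0 \<in> ?I" by (simp add: eps_def is_ideal_zero I)
    ultimately have "{x \<in> free_mod (b' 0). eps x \<in> ?I} = {0}" using F0 by (auto simp: b'0)
    with True D0 show ?thesis by (simp add: b'_def)
  next
    case False
    then have "{x \<in> free_mod (b 0). eps x \<in> ?I} = matapp (d 1) (b 0) (b 1) ` free_mod (b 1)"
      using res' by simp
    with False show ?thesis by (simp add: D_def b'_def)
  qed
  \<comment> \<open>The cokernel of the first map is R/I; \<open>y\<close> lifts to the free module
    the class that all variables of \<open>C\<close> kill.\<close>
  obtain y where y: "y \<in> free_mod (b 0)" "?f - eps y \<in> ?I" using res' by blast
  obtain vs where vs: "distinct vs" "set vs = C"
    using finite_distinct_list[of C] by auto
  have "0 + length (map Var vs :: ('v, 'k) mpoly list) \<le> p"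
  proof (rule resolution_length_ge_regular_seq[where b = b' and d = d and Q = "{0}" and y = y, folded D_def])
    show "b' j = 0" if "p < j" for j using that by (simp add: b'_def)
  next
    show "D j (D (Suc j) x) = 0" if "1 \<le> j" "x \<in> free_mod (b' (Suc j))" for j x
      using exact[OF that(1)] that(2) by blast
  next
    show "is_ideal {0 :: ('v, 'k) mpoly}" by (simp add: is_ideal_def)
  next
    show "regular_seq {0 :: ('v, 'k) mpoly} (map Var vs)"
      using regular_seq_Vars[of vs "{}", where ?'k = 'k] vs(1) by simp
  next
    show "\<exists>w\<in>free_mod (b' (Suc j)). z - D (Suc j) w \<in> vec_in {0}"
      if "0 < j" "z \<in> free_mod (b' j)" "D j z \<in> vec_in {0}" for j z
    proof -
      have "z \<in> D (Suc j) ` free_mod (b' (Suc j))" using exact[of j] that V0 by auto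
      then show ?thesis by (auto simp: V0)
    qed
  next
    show "y \<in> free_mod (b' 0)" using y by (simp add: b'0)
  next
    fix w :: "nat \<Rightarrow> ('v, 'k) mpoly" assume "w \<in> free_mod (b' (Suc 0))"
    then have *: "D (Suc 0) w \<in> {x \<in> free_mod (b' 0). eps x \<in> ?I}" unfolding exact0 by simp
    show "y - D (Suc 0) w \<notin> vec_in {0}"
    proof
      assume "y - D (Suc 0) w \<in> vec_in {0}"
      then have "y = D (Suc 0) w" by (simp add: V0)
      with * have "eps y \<in> ?I" by simp
      then have "(?f - eps y) + eps y \<in> ?I" using y(2) by (intro is_ideal_add I)
      then show False using min_cover_sqf_monomial_compl(1)[OF C, where ?'k = 'k] by simp
    qed
  next
    fix x :: "('v, 'k) mpoly" assume "x \<in> set (map Var vs)"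
    then obtain v where v: "v \<in> C" "x = Var v" using vs by auto
    have "x * ?f \<in> ?I" unfolding v(2) by (rule min_cover_sqf_monomial_compl(2)[OF C v(1)])
    then have "x * ?f - x * (?f - eps y) \<in> ?I"
      by (rule is_ideal_diff[OF I _ is_ideal_mult[OF I y(2)]])
    moreover have "x * ?f - x * (?f - eps y) = eps (\<lambda>k. x * y k)"
      by (simp add: algebra_simps eps_def sum_distrib_left)
    ultimately have "(\<lambda>k. x * y k) \<in> {x \<in> free_mod (b' 0). eps x \<in> ?I}"
      using y(1) submodule_smult[OF submodule_free_mod] by (simp add: b'0)
    then have "(\<lambda>k. x * y k) \<in> D (Suc 0) ` free_mod (b' (Suc 0))" unfolding exact0 by simp
    then show "\<exists>w\<in>free_mod (b' (Suc 0)). (\<lambda>k. x * y k) - D (Suc 0) w \<in> vec_in {0}"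
      by (auto simp: V0)
  qed
  then show ?thesis using vs distinct_card[of vs] by simp
qed

subsection \<open>Lower bound for the arithmetical rank\<close>

text \<open>The substitution that sets the variables outside \<open>C\<close> to 1.\<close>

definition restr :: "'v::finite set \<Rightarrow> ('v \<Rightarrow>\<^sub>0 nat) \<Rightarrow> 'v \<Rightarrow>\<^sub>0 nat" where
  "restr C t = (\<Sum>v\<in>C. single v (lookup t v))"

definition specialize :: "'v::finite set \<Rightarrow> ('v, 'k::comm_ring_1) mpoly \<Rightarrow> ('v, 'k) mpoly" where
  "specialize C f = (\<Sum>t\<in>keys f. single (restr C t) (lookup f t))"

lemma lookup_restr: "lookup (restr C t) v = (if v \<in> C then lookup t v else 0)"
  by (simp add: restr_def lookup_sum lookup_single when_def)

lemma restr_add: "restr C (s + t) = restr C s + restr C t"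
  by (rule poly_mapping_eqI) (simp add: lookup_restr lookup_add)

lemma keys_restr: "keys (restr C t) = keys t \<inter> C"
  by (auto simp: in_keys_iff lookup_restr split: if_splits)

lemma specialize_add: "specialize C (f + g) = specialize C f + specialize C g"
  unfolding specialize_def by (rule setsum_keys_plus_distrib) (simp_all add: single_add)

lemma specialize_zero [simp]: "specialize C 0 = 0"
  by (simp add: specialize_def)

lemma specialize_single: "specialize C (single t a) = single (restr C t) a"
  by (simp add: specialize_def)

lemma specialize_mult: "specialize C (f * g) = specialize C f * specialize C g"
proof (induction f rule: poly_mapping_add_induct)
  case (single s a)
  show ?case
  proof (induction g rule: poly_mapping_add_induct)
    case (single t b)
    show ?case by (simp add: mult_single specialize_single restr_add)
  qed (simp_all add: distrib_left specialize_add)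
qed (simp_all add: distrib_right specialize_add)

lemma specialize_one: "specialize C 1 = 1"
  using specialize_single[of C 0 1] by (simp add: restr_def)

lemma specialize_power: "specialize C (f ^ k) = specialize C f ^ k"
  by (induction k) (simp_all add: specialize_one specialize_mult)

lemma specialize_sum: "specialize C (sum f A) = (\<Sum>i\<in>A. specialize C (f i))"
  by (induction A rule: infinite_finite_induct) (simp_all add: specialize_add)

definition polys_in :: "'v set \<Rightarrow> ('v, 'k::comm_ring_1) mpoly set" where
  "polys_in C = {f. \<forall>t\<in>keys f. keys t \<subseteq> C}"

lemma polys_in_mult:
  assumes "f \<in> polys_in C" "g \<in> polys_in C" shows "f * g \<in> polys_in C"
  unfolding polys_in_def
proof (intro CollectI ballI)
  fix t assume "t \<in> keys (f * g)"
  then obtain a b where "t = a + b" "a \<in> keys f" "b \<in> keys g" using keys_mult[of f g] by auto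
  with assms show "keys t \<subseteq> C" by (auto simp: polys_in_def keys_add_nat)
qed

lemma single_in_polys_in: "keys t \<subseteq> C \<Longrightarrow> single t a \<in> polys_in C"
  by (simp add: polys_in_def)

lemma polys_in_add:
  assumes "f \<in> polys_in C" "g \<in> polys_in C" shows "f + g \<in> polys_in C"
  using assms keys_add[of f g] unfolding polys_in_def by blast

lemma specialize_in_polys_in: "specialize C f \<in> polys_in C"
proof (induction f rule: poly_mapping_add_induct)
  case (single t a)
  show ?case by (simp add: specialize_single single_in_polys_in keys_restr)
next
  case (add f g)
  then show ?case by (simp add: specialize_add polys_in_add)
qed (simp add: polys_in_def)

lemma lookup_mult_zero:
  "lookup (f * g) 0 = lookup f 0 * lookup g 0" for f g :: "('v, 'k::comm_ring_1) mpoly"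
proof (induction f rule: poly_mapping_add_induct)
  case (single s a)
  show ?case
  proof (induction g rule: poly_mapping_add_induct)
    case (single t b)
    have "s + t = 0 \<longleftrightarrow> s = 0 \<and> t = 0" by (auto simp: poly_mapping_eq_iff fun_eq_iff lookup_add)
    then show ?case by (auto simp: mult_single lookup_single when_def)
  qed (simp_all add: distrib_left lookup_add)
qed (simp_all add: distrib_right lookup_add)

lemma lookup_power_zero: "lookup (f ^ k) 0 = lookup f 0 ^ k" for f :: "('v, 'k::comm_ring_1) mpoly"
  by (induction k) (simp_all add: lookup_mult_zero)

section \<open>Total degree and truncation\<close>

definition wt :: "('v::finite \<Rightarrow>\<^sub>0 nat) \<Rightarrow> nat" where
  "wt t = (\<Sum>v\<in>UNIV. lookup t v)"

lemma wt_add: "wt (s + t) = wt s + wt t"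
  by (simp add: wt_def lookup_add sum.distrib)

lemma wt_zero_iff: "wt t = 0 \<longleftrightarrow> t = 0"
  by (auto simp: wt_def poly_mapping_eq_iff fun_eq_iff)

text \<open>The n-th power of the ideal generated by all variables.\<close>

definition wt_ge :: "nat \<Rightarrow> ('v::finite, 'k::comm_ring_1) mpoly set" where
  "wt_ge n = {f. \<forall>t\<in>keys f. n \<le> wt t}"

lemma wt_ge_mult:
  assumes "f \<in> wt_ge m" "g \<in> wt_ge n" shows "f * g \<in> wt_ge (m + n)"
  unfolding wt_ge_def
proof (intro CollectI ballI)
  fix t assume "t \<in> keys (f * g)"
  then obtain a b where "t = a + b" "a \<in> keys f" "b \<in> keys g" using keys_mult[of f g] by auto
  with assms show "m + n \<le> wt t" by (auto simp: wt_ge_def wt_add add_mono)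
qed

lemma wt_ge_power: "f \<in> wt_ge 1 \<Longrightarrow> f ^ n \<in> wt_ge n"
  by (induction n) (use wt_ge_mult[of f 1] in \<open>auto simp: wt_ge_def[of 0]\<close>)

lemma wt_ge_prod_power:
  fixes u :: nat
  assumes "\<And>i. i < u \<Longrightarrow> q i \<in> wt_ge 1"
  shows "(\<Prod>i<u. q i ^ \<alpha> i) \<in> wt_ge (\<Sum>i<u. \<alpha> i)"
  using assms
proof (induction u)
  case (Suc u)
  then show ?case using wt_ge_mult[OF _ wt_ge_power[of "q u" "\<alpha> u"]] by simp
qed (simp add: wt_ge_def)

text \<open>The linear choice of representatives modulo \<open>wt_ge T\<close>. It makes the
  quotient space a subspace of the polynomials, where spans and independence can be formed.\<close>

definition trunc :: "nat \<Rightarrow> ('v::finite, 'k::comm_ring_1) mpoly \<Rightarrow> ('v, 'k) mpoly" where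
  "trunc T f = (\<Sum>t\<in>{t \<in> keys f. wt t < T}. single t (lookup f t))"

lemma lookup_trunc: "lookup (trunc T f) t = (if wt t < T then lookup f t else 0)"
  by (auto simp: trunc_def lookup_sum lookup_single when_def in_keys_iff)

lemma trunc_add: "trunc T (f + g) = trunc T f + trunc T g"
  by (rule poly_mapping_eqI) (simp add: lookup_trunc lookup_add)

lemma trunc_zero: "trunc T 0 = 0"
  by (simp add: trunc_def)

lemma trunc_sum: "trunc T (sum f A) = (\<Sum>i\<in>A. trunc T (f i))"
  by (induction A rule: infinite_finite_induct) (simp_all add: trunc_add trunc_zero)

lemma lookup_scale: "lookup (single 0 a * f) t = a * lookup f t" for f :: "('v, 'k::comm_ring_1) mpoly"
proof (induction f rule: poly_mapping_add_induct)
  case (single s b)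
  then show ?case by (simp add: mult_single lookup_single when_def)
qed (simp_all add: distrib_left lookup_add)

lemma trunc_scale: "trunc T (single 0 a * f) = single 0 a * trunc T f"
  by (rule poly_mapping_eqI) (simp add: lookup_trunc lookup_scale)

lemma trunc_wt_ge:
  assumes "f \<in> wt_ge n" "T \<le> n" shows "trunc T f = 0"
proof (rule poly_mapping_eqI)
  fix t show "lookup (trunc T f) t = lookup 0 t"
    using assms by (cases "t \<in> keys f") (force simp: lookup_trunc wt_ge_def not_in_keys_iff_lookup_eq_zero)+
qed

lemma single_one_eq_iff: "single s 1 = single t (1 :: 'k::comm_ring_1) \<longleftrightarrow> s = t"
proof
  assume "single s 1 = single t (1 :: 'k)"
  then have "keys (single s (1 :: 'k)) = keys (single t (1 :: 'k))" by (rule arg_cong)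
  then show "s = t" by simp
qed simp

definition box :: "'v::finite set \<Rightarrow> nat \<Rightarrow> ('v \<Rightarrow>\<^sub>0 nat) set" where
  "box C n = {t. keys t \<subseteq> C \<and> (\<forall>v\<in>C. lookup t v < n)}"

lemma card_box: "finite (box C n) \<and> card (box C n) = n ^ card C"
proof -
  let ?h = "\<lambda>g. \<Sum>v\<in>C. single v (g v :: nat)"
  have lookup_h: "lookup (?h g) v = (if v \<in> C then g v else 0)" for g v
    by (simp add: lookup_sum lookup_single when_def)
  have "inj_on ?h (C \<rightarrow>\<^sub>E {..<n})"
  proof (rule inj_onI)
    fix g g' assume g: "g \<in> C \<rightarrow>\<^sub>E {..<n}" "g' \<in> C \<rightarrow>\<^sub>E {..<n}" and eq: "?h g = ?h g'"
    show "g = g'"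
    proof (rule PiE_ext[OF g])
      fix v assume "v \<in> C"
      then show "g v = g' v" using lookup_h[of g v] lookup_h[of g' v] eq by simp
    qed
  qed
  moreover have "?h ` (C \<rightarrow>\<^sub>E {..<n}) = box C n"
  proof (intro equalityI subsetI)
    fix t assume "t \<in> ?h ` (C \<rightarrow>\<^sub>E {..<n})"
    then show "t \<in> box C n" by (auto simp: box_def in_keys_iff lookup_h split: if_splits)
  next
    fix t assume t: "t \<in> box C n"
    let ?g = "restrict (lookup t) C"
    have "t = ?h ?g"
      using t by (intro poly_mapping_eqI) (auto simp: lookup_h box_def in_keys_iff)
    moreover have "?g \<in> C \<rightarrow>\<^sub>E {..<n}" using t by (auto simp: box_def)
    ultimately show "t \<in> ?h ` (C \<rightarrow>\<^sub>E {..<n})" by (rule image_eqI)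
  qed
  ultimately have "bij_betw ?h (C \<rightarrow>\<^sub>E {..<n}) (box C n)" by (simp add: bij_betw_def)
  then have "card (box C n) = card (C \<rightarrow>\<^sub>E {..<n})" "finite (box C n) = finite (C \<rightarrow>\<^sub>E {..<n})"
    by (simp_all add: bij_betw_same_card[symmetric] bij_betw_finite[symmetric])
  then show ?thesis by (simp add: card_PiE finite_PiE)
qed

text \<open>Modulo degree \<open>T\<close>, every polynomial in the variables from \<open>C\<close> is a linear combination of the
  products of boundedly many monomials with power products of the \<open>q i\<close>. There are \<open>O(T^u)\<close> such
  products, but the space of these polynomials has dimension of order \<open>T^(card C)\<close>.\<close>

lemma card_le_of_Var_powers:
  fixes q :: "nat \<Rightarrow> ('v::finite, 'k::field) mpoly"
  assumes q0: "\<And>i. i < u \<Longrightarrow> lookup (q i) 0 = 0"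
    and pow: "\<And>v. v \<in> C \<Longrightarrow> \<exists>r. (\<forall>i<u. r i \<in> polys_in C) \<and> Var v ^ N = (\<Sum>i<u. r i * q i)"
  shows "card C \<le> u"
proof (rule ccontr)
  assume less: "\<not> card C \<le> u"
  interpret vs: vector_space "\<lambda>(c::'k) (f::('v, 'k) mpoly). single 0 c * f"
    by unfold_locales (simp_all add: distrib_left distrib_right single_add mult_single mult.assoc[symmetric])
  let ?h = "card C"
  \<comment> \<open>\<open>s\<close> exceeds the constant factor in the count below, so
    \<open>s ^ ?h\<close> with \<open>?h > u\<close> outgrows that constant times
    \<open>s ^ u\<close>. \<open>T\<close> lies above the total degree of all exponents in
    \<open>box C s\<close>.\<close>
  define s where "s = N ^ ?h * ?h ^ u + 1"
  define T where "T = ?h * s"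
  define mq where "mq \<alpha> = (\<Prod>i<u. q i ^ \<alpha> i)" for \<alpha> :: "nat \<Rightarrow> nat"
  \<comment> \<open>A monomial with an exponent of at least \<open>N\<close> can be rewritten
    through the \<open>q i\<close>, and a product of at least \<open>T\<close> factors
    \<open>q i\<close> truncates to zero. This leaves two finite ranges.\<close>
  define B where "B = (\<lambda>(\<beta>, \<alpha>). trunc T (single \<beta> 1 * mq \<alpha>)) ` (box C N \<times> ({..<u} \<rightarrow>\<^sub>E {..<T}))"
  have finB: "finite B" unfolding B_def using card_box[of C N] by (auto intro!: finite_imageI finite_PiE)
  have cardB: "card B \<le> N ^ ?h * T ^ u"
  proof -
    have "card B \<le> card (box C N \<times> ({..<u} \<rightarrow>\<^sub>E {..<T}))"
      unfolding B_def using card_box[of C N] by (intro card_image_le finite_cartesian_product finite_PiE) auto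
    then show ?thesis using card_box[of C N] by (simp add: card_cartesian_product card_PiE)
  qed
  have q_wt: "q i \<in> wt_ge 1" if "i < u" for i
    unfolding wt_ge_def
  proof (intro CollectI ballI)
    fix t assume "t \<in> keys (q i)"
    then have "t \<noteq> 0" using q0[OF that] by (auto simp: in_keys_iff)
    then show "1 \<le> wt t" using wt_zero_iff[of t] by linarith
  qed
  have mq_wt: "mq \<alpha> \<in> wt_ge (\<Sum>i<u. \<alpha> i)" for \<alpha>
    unfolding mq_def by (rule wt_ge_prod_power[OF q_wt])
  have wt_ge0: "f \<in> wt_ge 0" for f :: "('v, 'k) mpoly" by (simp add: wt_ge_def)
  have mq_upd: "mq (\<alpha>(i := Suc (\<alpha> i))) = mq \<alpha> * q i" if "i < u" for \<alpha> i
  proof -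
    have i: "i \<in> {..<u}" using that by simp
    have "(\<Prod>k\<in>{..<u} - {i}. q k ^ (\<alpha>(i := Suc (\<alpha> i))) k) = (\<Prod>k\<in>{..<u} - {i}. q k ^ \<alpha> k)"
      by (rule prod.cong) auto
    then show ?thesis
      unfolding mq_def prod.remove[OF finite_lessThan i] by (simp add: ac_simps)
  qed
  have sum_upd: "(\<Sum>k<u. (\<alpha>(i := Suc (\<alpha> i))) k) = Suc (\<Sum>k<u. \<alpha> k)" if "i < u" for \<alpha> i
  proof -
    have i: "i \<in> {..<u}" using that by simp
    have "(\<Sum>k\<in>{..<u} - {i}. (\<alpha>(i := Suc (\<alpha> i))) k) = (\<Sum>k\<in>{..<u} - {i}. \<alpha> k)"
      by (rule sum.cong) auto
    then show ?thesis unfolding sum.remove[OF finite_lessThan i] by simp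
  qed
  \<comment> \<open>Each rewriting of a power \<open>Var v ^ N\<close> adds one factor
    \<open>q i\<close>. The number \<open>n\<close> bounds how many rewritings can follow before the
    order reaches \<open>T\<close> and the truncation vanishes.\<close>
  have claim: "trunc T (f * mq \<alpha>) \<in> vs.span B" if "T \<le> (\<Sum>i<u. \<alpha> i) + n" "f \<in> polys_in C" for n \<alpha> f
    using that
  proof (induction n arbitrary: \<alpha> f)
    case 0
    have "f * mq \<alpha> \<in> wt_ge (0 + (\<Sum>i<u. \<alpha> i))" by (rule wt_ge_mult[OF wt_ge0 mq_wt])
    then have "trunc T (f * mq \<alpha>) = 0" using 0 by (intro trunc_wt_ge) auto
    then show ?case by (simp add: vs.span_zero)
  next
    case (Suc n)
    have mono: "trunc T (single t a * mq \<alpha>) \<in> vs.span B" if t: "keys t \<subseteq> C" for t a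
    proof (cases "t \<in> box C N")
      case True
      show ?thesis
      proof (cases "T \<le> (\<Sum>i<u. \<alpha> i)")
        case True
        have "single t a * mq \<alpha> \<in> wt_ge (0 + (\<Sum>i<u. \<alpha> i))" by (rule wt_ge_mult[OF wt_ge0 mq_wt])
        then have "trunc T (single t a * mq \<alpha>) = 0" using True by (intro trunc_wt_ge) auto
        then show ?thesis by (simp add: vs.span_zero)
      next
        case False
        have "\<alpha> i < T" if "i < u" for i
          using member_le_sum[of i "{..<u}" \<alpha>] that False by simp
        \<comment> \<open>The index set consists of extensional functions; only the values below
          \<open>u\<close> enter the product.\<close>
        then have "restrict \<alpha> {..<u} \<in> {..<u} \<rightarrow>\<^sub>E {..<T}" by auto
        moreover have "mq (restrict \<alpha> {..<u}) = mq \<alpha>" by (simp add: mq_def)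
        ultimately have "trunc T (single t 1 * mq \<alpha>) \<in> B"
          unfolding B_def using \<open>t \<in> box C N\<close> by (intro image_eqI[of _ _ "(t, restrict \<alpha> {..<u})"]) auto
        then have "single 0 a * trunc T (single t 1 * mq \<alpha>) \<in> vs.span B"
          by (intro vs.span_scale vs.span_base)
        moreover have "single 0 a * trunc T (single t 1 * mq \<alpha>) = trunc T (single t a * mq \<alpha>)"
          by (simp add: trunc_scale[symmetric] mult.assoc[symmetric] mult_single)
        ultimately show ?thesis by simp
      qed
    next
      case False
      \<comment> \<open>Outside the box some exponent reaches \<open>N\<close>, so a factor
        \<open>Var v ^ N\<close> splits off.\<close>
      then obtain v where v: "v \<in> C" "N \<le> lookup t v" using t by (auto simp: box_def not_less)
      define t' where "t' = t - single v N"
      have t': "t = t' + single v N"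
        using v by (intro poly_mapping_eqI) (auto simp: t'_def lookup_add lookup_minus lookup_single when_def)
      obtain r where r: "\<And>i. i < u \<Longrightarrow> r i \<in> polys_in C" "Var v ^ N = (\<Sum>i<u. r i * q i)"
        using pow[OF v(1)] by auto
      have "Var v ^ k = (single (single v k) 1 :: ('v, 'k) mpoly)" for k
        by (induction k) (simp_all add: Var_def mult_single single_add[symmetric])
      then have "single t a = single t' a * Var v ^ N" by (simp add: t' mult_single)
      then have "single t a * mq \<alpha> = (\<Sum>i<u. single t' a * (r i * q i) * mq \<alpha>)"
        by (simp add: r(2) sum_distrib_left sum_distrib_right)
      also have "\<dots> = (\<Sum>i<u. (single t' a * r i) * mq (\<alpha>(i := Suc (\<alpha> i))))"
        by (rule sum.cong) (simp_all add: mq_upd ac_simps)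
      finally have eq: "trunc T (single t a * mq \<alpha>) =
          (\<Sum>i<u. trunc T ((single t' a * r i) * mq (\<alpha>(i := Suc (\<alpha> i)))))" by (simp only: trunc_sum)
      have "keys t' \<subseteq> C" using t unfolding t' by (auto simp: keys_add_nat)
      then have "trunc T ((single t' a * r i) * mq (\<alpha>(i := Suc (\<alpha> i)))) \<in> vs.span B" if "i < u" for i
        using Suc.prems(1) that
        by (intro Suc.IH polys_in_mult single_in_polys_in r) (simp_all only: sum_upd)
      then show ?thesis unfolding eq by (intro vs.span_sum) simp
    qed
    have "f * mq \<alpha> = (\<Sum>t\<in>keys f. single t (lookup f t) * mq \<alpha>)"
      by (simp add: sum_distrib_right[symmetric] poly_mapping_sum_single)
    then have "trunc T (f * mq \<alpha>) = (\<Sum>t\<in>keys f. trunc T (single t (lookup f t) * mq \<alpha>))"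
      by (simp only: trunc_sum)
    also have "\<dots> \<in> vs.span B"
      using Suc.prems(2) by (intro vs.span_sum mono) (auto simp: polys_in_def)
    finally show ?case .
  qed
  have h: "1 \<le> ?h" using less by simp
  have "finite C" using h by (metis card.infinite not_one_le_zero)
  let ?M = "(\<lambda>\<beta>. single \<beta> (1::'k)) ` box C s"
  have "?M \<subseteq> vs.span B"
  proof
    fix f assume "f \<in> ?M"
    then obtain \<beta> where \<beta>: "\<beta> \<in> box C s" "f = single \<beta> 1" by auto
    have "wt \<beta> = (\<Sum>v\<in>C. lookup \<beta> v)"
      unfolding wt_def using \<beta>(1) by (intro sum.mono_neutral_right) (auto simp: box_def in_keys_iff)
    also have "\<dots> < (\<Sum>v\<in>C. s)"
      using \<beta>(1) h \<open>finite C\<close> by (intro sum_strict_mono) (auto simp: box_def)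
    finally have "wt \<beta> < T" by (simp add: T_def)
    then have "trunc T f = f"
      by (intro poly_mapping_eqI) (auto simp: lookup_trunc \<beta>(2) lookup_single when_def)
    \<comment> \<open>With exponent vector zero the power product is 1, and \<open>T\<close>
      rewritings are allowed.\<close>
    moreover have "trunc T (f * mq (\<lambda>_. 0)) \<in> vs.span B"
      using \<beta> by (intro claim[of _ T] ) (auto simp: box_def polys_in_def)
    ultimately show "f \<in> vs.span B" by (simp add: mq_def)
  qed
  moreover have "vs.independent ?M"
    unfolding vs.independent_explicit_module
  proof (intro allI impI)
    fix A c f assume A: "finite A" "A \<subseteq> ?M" "(\<Sum>v\<in>A. single 0 (c v) * v) = 0" "f \<in> A"
    then obtain \<beta> where \<beta>: "f = single \<beta> 1" by auto
    have "lookup (\<Sum>v\<in>A. single 0 (c v) * v) \<beta> = (\<Sum>v\<in>A. if v = f then c f else 0)"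
      unfolding lookup_sum
    proof (rule sum.cong)
      fix g assume "g \<in> A"
      then obtain \<gamma> where "g = single \<gamma> 1" using A by auto
      then show "lookup (single 0 (c g) * g) \<beta> = (if g = f then c f else 0)"
        by (auto simp: lookup_scale \<beta> lookup_single when_def single_one_eq_iff)
    qed simp
    then show "c f = 0" using A by simp
  qed
  ultimately have "card ?M \<le> card B" using vs.independent_span_bound[OF finB] by blast
  moreover have "card ?M = s ^ ?h"
    using card_box[of C s] by (subst card_image) (auto simp: inj_on_def single_one_eq_iff)
  ultimately have "s ^ ?h \<le> N ^ ?h * (?h * s) ^ u" using cardB by (simp add: T_def)
  also have "\<dots> = (N ^ ?h * ?h ^ u) * s ^ u" by (simp add: power_mult_distrib)
  \<comment> \<open>The summand 1 in \<open>s\<close> makes this strict.\<close>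
  also have "\<dots> < s * s ^ u" by (intro mult_strict_right_mono) (simp_all add: s_def)
  also have "\<dots> = s ^ Suc u" by simp
  also have "\<dots> \<le> s ^ ?h" using less by (intro power_increasing) (auto simp: s_def)
  finally show False by simp
qed

text \<open>Every monomial of the ideal meets \<open>C\<close> and keeps a variable under the
  substitution, so constant terms vanish, also for the \<open>q i\<close> since a field is reduced.
  A generator that meets \<open>C\<close> only in \<open>v\<close> becomes \<open>Var v\<close>,
  some power of which therefore lies in the ideal of the substituted \<open>q i\<close>.\<close>

lemma card_min_cover_le_generators:
  fixes q :: "nat \<Rightarrow> ('v::finite, 'k::field) mpoly"
  assumes rad: "radical (ideal_gen (q ` {..<u})) = radical (mono_ideal \<S>)"
    and C: "min_cover C \<S>"
  shows "card C \<le> u"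
proof -
  let ?I = "mono_ideal \<S> :: ('v, 'k) mpoly set"
  have const: "lookup (specialize C f) 0 = 0" if "f \<in> ?I" for f
  proof -
    have "restr C t \<noteq> 0" if "t \<in> keys f" for t
    proof -
      obtain S where "S \<in> \<S>" "S \<subseteq> keys t" using mono_idealD[OF \<open>f \<in> ?I\<close> \<open>t \<in> keys f\<close>] by auto
      then have "keys t \<inter> C \<noteq> {}" using C unfolding min_cover_def by blast
      then show ?thesis using keys_restr[of C t] by auto
    qed
    then show ?thesis by (simp add: specialize_def lookup_sum lookup_single when_def)
  qed
  have q0: "lookup (specialize C (q i)) 0 = 0" if "i < u" for i
  proof -
    have "q i \<in> ideal_gen (q ` {..<u})" using that by (intro ideal_gen_superset) auto
    then have "q i \<in> radical ?I" using rad radical_superset by blast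
    then obtain k where "q i ^ k \<in> ?I" by (auto simp: radical_def)
    then have "lookup (specialize C (q i)) 0 ^ k = 0"
      using const by (simp add: lookup_power_zero[symmetric] specialize_power[symmetric])
    then show ?thesis by simp
  qed
  have "\<exists>k r. Var v ^ k = (\<Sum>i<u. specialize C (r i) * specialize C (q i))" if "v \<in> C" for v
  proof -
    obtain S where S: "S \<in> \<S>" "S \<inter> C = {v}" using C \<open>v \<in> C\<close> unfolding min_cover_def by blast
    have "sqf_monomial S \<in> ?I" using S by (auto simp: sqf_monomial_in_mono_ideal)
    then have "sqf_monomial S \<in> radical (ideal_gen (q ` {..<u}))" using rad radical_superset by blast
    then obtain k where "sqf_monomial S ^ k \<in> ideal_gen (q ` {..<u})" by (auto simp: radical_def)
    then obtain r where "sqf_monomial S ^ k = (\<Sum>i<u. r i * q i)" using ideal_gen_finite_image by blast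
    then have "specialize C (sqf_monomial S ^ k) = (\<Sum>i<u. specialize C (r i) * specialize C (q i))"
      by (simp add: specialize_sum specialize_mult)
    moreover have "restr C (expo S) = single v 1"
      using S(2) by (intro poly_mapping_eqI) (auto simp: lookup_restr lookup_expo lookup_single when_def)
    then have "specialize C (sqf_monomial S :: ('v, 'k) mpoly) = Var v"
      by (simp add: sqf_monomial_eq_single specialize_single Var_def)
    ultimately show ?thesis by (auto simp: specialize_power)
  qed
  then obtain k r where kr: "\<And>v. v \<in> C \<Longrightarrow>
      Var v ^ k v = (\<Sum>i<u. specialize C (r v i) * specialize C (q i))" by metis
  \<comment> \<open>A common exponent for all variables; unlike a maximum, the sum makes sense for
    empty \<open>C\<close>.\<close>
  define N where "N = sum k C"
  show ?thesis
  proof (rule card_le_of_Var_powers[where q = "\<lambda>i. specialize C (q i)" and N = N, OF q0])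
    fix v assume v: "v \<in> C"
    have "k v \<le> N" unfolding N_def using v by (intro member_le_sum) auto
    then have "Var v ^ N = Var v ^ (N - k v) * (Var v ^ k v :: ('v, 'k) mpoly)"
      by (simp add: power_add[symmetric])
    also have "\<dots> = (\<Sum>i<u. (Var v ^ (N - k v) * specialize C (r v i)) * specialize C (q i))"
      by (simp add: kr[OF v] sum_distrib_left mult.assoc)
    finally have eq: "Var v ^ N = (\<Sum>i<u. (Var v ^ (N - k v) * specialize C (r v i)) * specialize C (q i))" .
    have "Var v ^ n \<in> (polys_in C :: ('v, 'k) mpoly set)" for n
      by (induction n) (auto intro!: polys_in_mult simp: Var_def v single_in_polys_in, simp add: polys_in_def)
    then show "\<exists>r. (\<forall>i<u. r i \<in> polys_in C) \<and> Var v ^ N = (\<Sum>i<u. r i * specialize C (q i))"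
      using eq by (intro exI[of _ "\<lambda>i. Var v ^ (N - k v) * specialize C (r v i)"])
        (auto intro!: polys_in_mult specialize_in_polys_in)
  qed
qed

text \<open>A face collects the generators divisible by one variable, so faces of at most two
  consecutive vertices forbid common variables at distance two or more. An inner vertex is open
  exactly when each of its variables also lies in a neighbour.\<close>

lemma string_gen_string:
  fixes ms :: "nat \<Rightarrow> 'v set"
  assumes minimal: "\<forall>j\<in>{1..\<mu>}. \<forall>k\<in>{1..\<mu>}. j \<noteq> k \<longrightarrow> \<not> ms j \<subseteq> ms k"
    and string: "is_string (assoc_hypergraph ms \<mu>) \<mu>"
  shows "gen_string (\<lambda>i. ms i \<subseteq> ms (i - 1) \<union> ms (Suc i)) ms \<mu>"
proof -
  have \<mu>: "2 \<le> \<mu>" using string by (simp add: is_string_def)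
  have edge: "{j, j + 1} \<in> assoc_hypergraph ms \<mu>" if "j \<in> {1..<\<mu>}" for j
    using string that by (simp add: is_string_def)
  have faces: "(\<exists>j. F = {j, j + 1}) \<or> (\<exists>j. F = {j})" if "F \<in> assoc_hypergraph ms \<mu>" for F
    using string that unfolding is_string_def by blast
  show ?thesis
    unfolding gen_string_def
  proof (intro conjI allI impI)
    fix i k assume ik: "1 \<le> i" "i + 2 \<le> k" "k \<le> \<mu>"
    show "ms i \<inter> ms k = {}"
    proof (rule ccontr)
      assume "ms i \<inter> ms k \<noteq> {}"
      then obtain v where v: "v \<in> ms i" "v \<in> ms k" by auto
      let ?F = "{j \<in> {1..\<mu>}. v \<in> ms j}"
      have "?F \<in> assoc_hypergraph ms \<mu>"
        unfolding assoc_hypergraph_def using v ik by (intro CollectI exI[of _ v]) auto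
      then obtain j where "?F \<subseteq> {j, j + 1}" using faces by blast
      moreover have "i \<in> ?F" "k \<in> ?F" using v ik by auto
      ultimately have "i \<in> {j, j + 1}" "k \<in> {j, j + 1}" by blast+
      then show False using ik by auto
    qed
  next
    fix i assume i: "1 \<le> i" "i < \<mu>"
    then have "{i, i + 1} \<in> assoc_hypergraph ms \<mu>" by (intro edge) auto
    then obtain v where v: "{i, i + 1} = {j \<in> {1..\<mu>}. v \<in> ms j}"
      unfolding assoc_hypergraph_def by blast
    have "i \<in> {i, i + 1}" "i + 1 \<in> {i, i + 1}" by auto
    then have "v \<in> ms i" "v \<in> ms (i + 1)" unfolding v by auto
    then show "ms i \<inter> ms (Suc i) \<noteq> {}" by auto
    show "\<not> ms i \<subseteq> ms (Suc i)" "\<not> ms (Suc i) \<subseteq> ms i" using minimal i by auto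
  next
    fix i assume i: "1 \<le> i" "i \<le> \<mu>"
    \<comment> \<open>Any second vertex will do: an empty set would be contained in its generator,
      against minimality.\<close>
    let ?k = "if i = 1 then 2 else 1"
    have "?k \<in> {1..\<mu>}" "i \<noteq> ?k" using \<mu> by auto
    then have "\<not> ms i \<subseteq> ms ?k" using minimal i by (simp del: One_nat_def split del: if_split)
    then show "ms i \<noteq> {}" by blast
  qed simp
qed

theorem theorem3p1:
  fixes ms :: "nat \<Rightarrow> 'v::finite set" and \<mu> :: nat
  assumes minimal: "\<forall>j\<in>{1..\<mu>}. \<forall>k\<in>{1..\<mu>}. j \<noteq> k \<longrightarrow> \<not> ms j \<subseteq> ms k"
    and string: "is_string (assoc_hypergraph ms \<mu>) \<mu>"
  shows "ara (sqf_ideal ms \<mu> :: ('v, 'k::field) mpoly set) = biara (sqf_ideal ms \<mu> :: ('v, 'k) mpoly set)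
       \<and> biara (sqf_ideal ms \<mu> :: ('v, 'k) mpoly set) = pd_quot (sqf_ideal ms \<mu> :: ('v, 'k) mpoly set)"
proof -
  define opn where "opn = (\<lambda>i. ms i \<subseteq> ms (i - 1) \<union> ms (Suc i))"
  have gs: "gen_string opn ms \<mu>" unfolding opn_def by (rule string_gen_string[OF minimal string])
  let ?\<S> = "ms ` {1..\<mu>}" and ?n = "string_rank opn \<mu>"
  let ?I = "mono_ideal ?\<S> :: ('v, 'k) mpoly set"
  obtain C where C: "min_cover C ?\<S>" "card C = ?n" using min_cover_string_exists[OF gs] by auto
  have ge: "?n \<le> u" if "radical (ideal_gen (q ` {..<u})) = radical ?I" for u and q :: "nat \<Rightarrow> ('v, 'k) mpoly"
    using card_min_cover_le_generators[OF that C(1)] C(2) by simp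
  obtain Q :: "('v, 'k) mpoly set" where Q: "finite Q" "card Q \<le> ?n" "\<forall>q\<in>Q. mono_or_binomial q"
    "Q \<subseteq> ?I" "sqf_monomial ` ?\<S> \<subseteq> radical (ideal_gen Q)"
    using binomials_string_exist[OF gs] by blast
  obtain h where h: "bij_betw h {..<card Q} Q" using ex_bij_betw_nat_finite[OF Q(1)]
    by (auto simp: atLeast0LessThan)
  \<comment> \<open>Padding with zeros up to the length \<open>?n\<close>; zero has no monomials, so
    it passes as a monomial or binomial.\<close>
  define q where "q i = (if i < card Q then h i else 0)" for i
  have "Q \<subseteq> q ` {..<?n}"
  proof
    fix x assume "x \<in> Q"
    then obtain i where "i < card Q" "x = h i" using h by (auto simp: bij_betw_def)
    then show "x \<in> q ` {..<?n}" using Q(2) by (auto simp: q_def)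
  qed
  then have "sqf_monomial ` ?\<S> \<subseteq> radical (ideal_gen (q ` {..<?n}))"
    using Q(5) radical_mono[OF ideal_gen_mono] by blast
  moreover have hQ: "h i \<in> Q" if "i < card Q" for i using h that by (auto simp: bij_betw_def)
  have "q ` {..<?n} \<subseteq> ideal_gen (sqf_monomial ` ?\<S>)"
    unfolding ideal_gen_sqf_monomial using hQ Q(4) is_ideal_zero[OF is_ideal_mono_ideal[of ?\<S>]]
    by (auto simp: q_def)
  ultimately have rad: "radical (ideal_gen (q ` {..<?n})) = radical ?I"
    unfolding ideal_gen_sqf_monomial[symmetric] by (intro radical_ideal_gen_eqI)
  have mob: "\<forall>i<?n. mono_or_binomial (q i)"
    using hQ Q(3) by (simp add: q_def) (simp add: mono_or_binomial_def)
  have "ara ?I = ?n"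
    unfolding ara_def by (rule Least_equality) (use rad ge in blast)+
  moreover have "biara ?I = ?n"
    unfolding biara_def by (rule Least_equality) (use rad mob ge in blast)+
  moreover have "pd_quot ?I = ?n"
    unfolding pd_quot_def
  proof (rule Least_equality)
    show "\<exists>b d e. is_free_resolution ?I ?n b d e"
      by (rule resolvable_imp_free_resolution[OF resolvable_string[OF gs] is_ideal_mono_ideal])
    show "?n \<le> p" if "\<exists>b d e. is_free_resolution ?I p b d e" for p
    proof -
      from that obtain b d e where "is_free_resolution ?I p b d e" by blast
      from free_resolution_length_ge_min_cover[OF this C(1)] show ?thesis using C(2) by simp
    qed
  qed
  ultimately show ?thesis by (simp add: sqf_ideal_eq_mono_ideal)
qed

end
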